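(* Let $\mathbb{H}$ be a gehm. If $\mathbb{H}$ has no hyperedges then $T(\mathbb{H};x,y)=1$. Otherwise, for each hyperedge $e$, \[T(\mathbb{H};x,y)=\sqrt{x-1}^{\,f(\mathbb{H}\setminus e)-f(\mathbb{H})+d(e)-1}\,T(\mathbb{H}\setminus e;x,y)+\sqrt{y-1}^{\,v(\mathbb{H}/ e)-v(\mathbb{H})+d(e)-1}\,T(\mathbb{H}/ e;x,y).\]
   Context: A gehm is a finite cubic graph whose edges are properly coloured with colours $b,g,r$, together with possibly some isolates ($g$-coloured edges meeting no vertex). Hyperedges are $b$--$r$-cycles, hyperfaces are $b$--$g$-cycles or isolates, hypervertices are $g$--$r$-cycles or isolates. $E(\mathbb{H})$, $e(\mathbb{H})$, $v(\mathbb{H})$, $f(\mathbb{H})$: set of hyperedges and numbers of hyperedges, hypervertices, hyperfaces; $k(\mathbb{H})$: number of components (isolates count); $d(e)$: half the number of gehm-edges in hyperedge $e$, $d(A)=\sum_{e\in A}d(e)$, $d(\mathbb{H})=d(E(\mathbb{H}))$; $\gamma(\mathbb{H})=2k(\mathbb{H})-v(\mathbb{H})-e(\mathbb{H})+d(\mathbb{H})-f(\mathbb{H})$. Suppressing a degree-two vertex: if its only edge is a loop, replace it and the loop by an isolate; otherwise contract one incident edge. $\mathbb{H}\setminus e$: delete the $b$-edges of $e$, contract its $r$-edges, suppress degree-two vertices. $\mathbb{H}/ e$: delete the $r$-edges of $e$, contract its $b$-edges, suppress degree-two vertices. For $A\subseteq E(\mathbb{H})$, $\mathbb{H}_{|A}$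 is obtained by deleting all hyperedges not in $A$; $v(A),k(A),f(A),\gamma(A)$ are the quantities of $\mathbb{H}_{|A}$. $\rho(\mathbb{H})=v(\mathbb{H})-k(\mathbb{H})+\tfrac12\gamma(\mathbb{H})$, $\rho(A)=v(A)-k(A)+\tfrac12\gamma(A)$. $T(\mathbb{H};x,y)=\sum_{A\subseteq E(\mathbb{H})}(x-1)^{\rho(\mathbb{H})-\rho(A)}(y-1)^{d(A)-|A|-\rho(A)}$. *)

theory Defs
  imports Complex_Main "HOL-Library.While_Combinator"
begin

datatype colour = Blue | Green | Red

text \<open>
  Edge-coloured multigraphs. An edge with two ends is a link, one with a single end is a loop,
  and one with no end is an edge meeting no vertex.
\<close>

record ('v, 'e) cgraph =
  verts :: "'v set"
  edges :: "'e set"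
  ends :: "'e \<Rightarrow> 'v set"
  col :: "'e \<Rightarrow> colour"

definition degree :: "('v, 'e) cgraph \<Rightarrow> 'v \<Rightarrow> nat" where
  "degree G v = card {f \<in> edges G. v \<in> ends G f} + card {f \<in> edges G. ends G f = {v}}"

definition linked :: "('v, 'e) cgraph \<Rightarrow> 'e set \<Rightarrow> ('v \<times> 'v) set" where
  "linked G F = {(u, w). \<exists>f\<in>F. u \<in> ends G f \<and> w \<in> ends G f}\<^sup>*"

definition isolates :: "('v, 'e) cgraph \<Rightarrow> 'e set" where
  "isolates G = {f \<in> edges G. col G f = Green \<and> ends G f = {}}"

text \<open>
  A proper edge colouring excludes loops. Parallel edges (of different colours) are allowed.
\<close>

definition gehm :: "('v, 'e) cgraph \<Rightarrow> bool" where
  "gehm H \<longleftrightarrow>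
     finite (verts H) \<and> finite (edges H) \<and>
     (\<forall>f\<in>edges H. ends H f \<subseteq> verts H) \<and>
     (\<forall>f\<in>edges H. card (ends H f) = 2 \<or> f \<in> isolates H) \<and>
     (\<forall>v\<in>verts H. degree H v = 3) \<and>
     (\<forall>f\<in>edges H. \<forall>g\<in>edges H. f \<noteq> g \<and> ends H f \<inter> ends H g \<noteq> {} \<longrightarrow> col H f \<noteq> col H g)"


text \<open>Cycles are identified with their edge sets: connected subgraphs that are 2-regular.\<close>

definition is_cycle :: "('v, 'e) cgraph \<Rightarrow> 'e set \<Rightarrow> bool" where
  "is_cycle G C \<longleftrightarrow>
     C \<subseteq> edges G \<and> C \<noteq> {} \<and> (\<forall>f\<in>C. ends G f \<noteq> {}) \<and>
     (\<forall>u\<in>\<Union>(ends G ` C). \<forall>w\<in>\<Union>(ends G ` C). (u, w) \<in> linked G C) \<and>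
     (\<forall>v\<in>\<Union>(ends G ` C). degree (G\<lparr>edges := C\<rparr>) v = 2)"

definition cycles :: "('v, 'e) cgraph \<Rightarrow> colour \<Rightarrow> colour \<Rightarrow> 'e set set" where
  "cycles G c c' = {C. is_cycle G C \<and> col G ` C \<subseteq> {c, c'}}"

definition hyperedges :: "('v, 'e) cgraph \<Rightarrow> 'e set set" where
  "hyperedges H = cycles H Blue Red"

definition hyperfaces :: "('v, 'e) cgraph \<Rightarrow> 'e set set" where
  "hyperfaces H = cycles H Blue Green \<union> {{i} | i. i \<in> isolates H}"

definition hypervertices :: "('v, 'e) cgraph \<Rightarrow> 'e set set" where
  "hypervertices H = cycles H Green Red \<union> {{i} | i. i \<in> isolates H}"

definition num_e :: "('v, 'e) cgraph \<Rightarrow> nat" where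
  "num_e H = card (hyperedges H)"

definition num_f :: "('v, 'e) cgraph \<Rightarrow> nat" where
  "num_f H = card (hyperfaces H)"

definition num_v :: "('v, 'e) cgraph \<Rightarrow> nat" where
  "num_v H = card (hypervertices H)"

definition num_k :: "('v, 'e) cgraph \<Rightarrow> nat" where
  "num_k H = card (verts H // linked H (edges H)) + card (isolates H)"

text \<open>The division is exact on hyperedges, as blue and red edges alternate.\<close>

definition deg :: "'e set \<Rightarrow> nat" where
  "deg e = card e div 2"

definition deg_sum :: "'e set set \<Rightarrow> nat" where
  "deg_sum A = (\<Sum>e\<in>A. deg e)"

definition gamma :: "('v, 'e) cgraph \<Rightarrow> int" where
  "gamma H = 2 * int (num_k H) - int (num_v H) - int (num_e H)
     + int (deg_sum (hyperedges H)) - int (num_f H)"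

definition rho :: "('v, 'e) cgraph \<Rightarrow> real" where
  "rho H = real (num_v H) - real (num_k H) + of_int (gamma H) / 2"


definition delete_edges :: "('v, 'e) cgraph \<Rightarrow> 'e set \<Rightarrow> ('v, 'e) cgraph" where
  "delete_edges G F = G\<lparr>edges := edges G - F\<rparr>"

text \<open>
  Contraction identifies the vertices within each component of the subgraph with edge set F,
  a component being named by one of its vertices. Surviving edges keep their names.
\<close>

definition merged :: "('v, 'e) cgraph \<Rightarrow> 'e set \<Rightarrow> 'v \<Rightarrow> 'v" where
  "merged G F v = (SOME u. (v, u) \<in> linked G F)"

definition contract_edges :: "('v, 'e) cgraph \<Rightarrow> 'e set \<Rightarrow> ('v, 'e) cgraph" where
  "contract_edges G F =
     G\<lparr>verts := merged G F ` verts G,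
       edges := edges G - F,
       ends := (\<lambda>f. merged G F ` ends G f)\<rparr>"

text \<open>
  For vertices of degree two. The loop itself becomes the isolate; in all uses below it is green,
  because only green edges meet the degree-two vertices that arise.
\<close>

definition suppress_vertex :: "('v, 'e) cgraph \<Rightarrow> 'v \<Rightarrow> ('v, 'e) cgraph" where
  "suppress_vertex G v =
     (if \<exists>f\<in>edges G. ends G f = {v}
      then G\<lparr>verts := verts G - {v},
             ends := (\<lambda>f. if ends G f = {v} then {} else ends G f)\<rparr>
      else contract_edges G {SOME f. f \<in> edges G \<and> v \<in> ends G f})"

definition suppress :: "('v, 'e) cgraph \<Rightarrow> ('v, 'e) cgraph" where
  "suppress =
     while (\<lambda>G. \<exists>v\<in>verts G. degree G v = 2)
           (\<lambda>G. suppress_vertex G (SOME v. v \<in> verts G \<and> degree G v = 2))"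

text \<open>
  Edge names survive all of these operations, so the hyperedges of a gehm that are not deleted or
  contracted are, as edge sets, literally hyperedges of the result.
\<close>

definition edges_of :: "('v, 'e) cgraph \<Rightarrow> colour \<Rightarrow> 'e set set \<Rightarrow> 'e set" where
  "edges_of H c S = {f \<in> \<Union>S. col H f = c}"

definition delete_hyperedges :: "('v, 'e) cgraph \<Rightarrow> 'e set set \<Rightarrow> ('v, 'e) cgraph" where
  "delete_hyperedges H S =
     suppress (contract_edges (delete_edges H (edges_of H Blue S)) (edges_of H Red S))"

definition delete_hyperedge :: "('v, 'e) cgraph \<Rightarrow> 'e set \<Rightarrow> ('v, 'e) cgraph" where
  "delete_hyperedge H e = delete_hyperedges H {e}"

definition contract_hyperedge :: "('v, 'e) cgraph \<Rightarrow> 'e set \<Rightarrow> ('v, 'e) cgraph" where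
  "contract_hyperedge H e =
     suppress (contract_edges (delete_edges H (edges_of H Red {e})) (edges_of H Blue {e}))"

definition restrict_to :: "('v, 'e) cgraph \<Rightarrow> 'e set set \<Rightarrow> ('v, 'e) cgraph" where
  "restrict_to H A = delete_hyperedges H (hyperedges H - A)"


text \<open>
  The power of z with exponent q, for half-integral q, as a power of the principal square root.
  Unlike powr, it takes the value 1 at z = 0, q = 0. The exponents below are half-integral
  because 2 rho is always an integer.
\<close>

definition half_pow :: "complex \<Rightarrow> real \<Rightarrow> complex" where
  "half_pow z q = csqrt z powi \<lfloor>2 * q\<rfloor>"

definition tutte :: "('v, 'e) cgraph \<Rightarrow> complex \<Rightarrow> complex \<Rightarrow> complex" where
  "tutte H x y =
     (\<Sum>A\<in>Pow (hyperedges H).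
        half_pow (x - 1) (rho H - rho (restrict_to H A)) *
        half_pow (y - 1) (real (deg_sum A) - real (card A) - rho (restrict_to H A)))"

end

theory Submission
  imports Defs
begin

text \<open>
  In \<open>\<rho> = (v - e + d - f)/2\<close> the number of components cancels. Suppression and contraction of edges
  preserve the number of components, isolates included, of every spanning subgraph that contains the
  green edges. As 2-coloured cycles are the components of 2-coloured subgraphs, \<open>v\<close> and \<open>f\<close> of any
  minor of \<open>H\<close> can be read off in \<open>H\<close>: deleting \<open>e\<close> replaces its blue edges by its red ones in the
  count of hyperfaces and does not change \<open>v\<close>, and contracting \<open>e\<close> is dual. The two
  terms of the recursion are then the subsets avoiding and containing \<open>e\<close>. At \<open>x = 1\<close> or \<open>y = 1\<close> splitting
  the powers needs nonnegative exponents, which hold because exchanging the colours of \<open>e\<close> changes the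
  number of components by at most \<open>d(e) - 1\<close>.
\<close>

text \<open>The minors of \<open>H\<close> depend on arbitrary choices: \<open>merged\<close> picks
  representatives, \<open>suppress\<close> picks vertices and edges. A restriction of
  \<open>delete_hyperedge H e\<close> is therefore never compared with a restriction of
  \<open>H\<close> as a graph. What can be compared are the non-green edges, which keep their names,
  and numbers of components. All of these numbers become values of one function,
  \<open>twist H S\<close>: the components, isolates included, when the hyperedges in
  \<open>S\<close> contribute their red edges, the others their blue ones, and the green edges are
  always present. Its values at the empty set and at \<open>hyperedges H\<close> are f and v, and
  its value at the complement of \<open>A\<close> is f(A). So T depends only on
  \<open>twist H\<close> and on the degrees of the hyperedges. Deleting \<open>e\<close> restricts
  \<open>twist H\<close> to the sets that contain \<open>e\<close>, contracting \<open>e\<close>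
  restricts it to the sets that avoid \<open>e\<close>, and the recursion becomes the splitting of a
  power set.\<close>

section \<open>Incidences and degrees by colour\<close>

definition incidence :: "('v, 'e) cgraph \<Rightarrow> 'e \<Rightarrow> 'v \<Rightarrow> nat" where
  "incidence G f v = of_bool (v \<in> ends G f) + of_bool (ends G f = {v})"

text \<open>Split by colour, "cubic and properly coloured" becomes the numerical condition that all
  three degrees are 1, and the effect of a contraction on it is linear.\<close>

definition cdegree :: "('v, 'e) cgraph \<Rightarrow> colour \<Rightarrow> 'v \<Rightarrow> nat" where
  "cdegree G c v = (\<Sum>f | f \<in> edges G \<and> col G f = c. incidence G f v)"

text \<open>The case \<open>p = q\<close> is included: a loop counts twice. The right side is
  additive in the two ends, so incidences can be summed over vertices that get identified.\<close>

lemma incidence_pair: "ends G f = {p, q} \<Longrightarrow> incidence G f v = of_bool (v = p) + of_bool (v = q)"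
  by (auto simp: incidence_def doubleton_eq_iff)

lemma incidence_empty: "ends G f = {} \<Longrightarrow> incidence G f v = 0"
  by (auto simp: incidence_def)

lemma incidence_eq_0: "incidence G f v = 0 \<longleftrightarrow> v \<notin> ends G f"
  by (auto simp: incidence_def)

lemma card_le_2_cases:
  assumes "finite A" "card A \<le> 2"
  obtains "A = {}" | p q where "A = {p, q}"
proof -
  consider "card A = 0" | "card A = 1" | "card A = 2" using assms(2) by linarith
  then show thesis
  proof cases
    case 1 then show ?thesis using assms that by simp
  next
    case 2 then obtain p where "A = {p}" by (auto simp: card_1_singleton_iff)
    then show ?thesis using that(2)[of p p] by simp
  next
    case 3 then show ?thesis using that by (metis card_2_iff)
  qed
qed

lemma degree_sum_incidence:
  assumes "finite (edges G)"
  shows "degree G v = (\<Sum>f\<in>edges G. incidence G f v)"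
proof -
  have "(\<Sum>f\<in>edges G. of_bool (P f) :: nat) = card {f \<in> edges G. P f}" for P
    using assms by (simp add: sum.If_cases Int_def conj_commute)
  then show ?thesis by (simp add: degree_def incidence_def sum.distrib)
qed

lemma degree_sum_cdegree:
  assumes "finite (edges G)"
  shows "degree G v = cdegree G Blue v + cdegree G Green v + cdegree G Red v"
proof -
  have "edges G = {f. f \<in> edges G \<and> col G f = Blue} \<union>
      ({f. f \<in> edges G \<and> col G f = Green} \<union> {f. f \<in> edges G \<and> col G f = Red})"
    using colour.exhaust by auto
  then have "degree G v = (\<Sum>f\<in>{f. f \<in> edges G \<and> col G f = Blue} \<union>
      ({f. f \<in> edges G \<and> col G f = Green} \<union> {f. f \<in> edges G \<and> col G f = Red}). incidence G f v)"
    using degree_sum_incidence[OF assms, of v] by simp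
  also have "\<dots> = cdegree G Blue v + (cdegree G Green v + cdegree G Red v)"
    unfolding cdegree_def using assms
    by (subst sum.union_disjoint; (subst sum.union_disjoint)?; auto)
  finally show ?thesis by simp
qed

lemma incidence_le_cdegree:
  assumes "finite (edges G)" "f \<in> edges G"
  shows "incidence G f v \<le> cdegree G (col G f) v"
  unfolding cdegree_def using assms by (intro member_le_sum) auto

lemma incidence_add_le_cdegree:
  assumes "finite (edges G)" "f \<in> edges G" "g \<in> edges G" "f \<noteq> g" "col G f = col G g"
  shows "incidence G f v + incidence G g v \<le> cdegree G (col G f) v"
proof -
  have "(\<Sum>h\<in>{f, g}. incidence G h v) \<le> cdegree G (col G f) v"
    unfolding cdegree_def using assms by (intro sum_mono2) auto
  then show ?thesis using assms(4) by simp
qed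

subsection \<open>Components and contraction\<close>

abbreviation adjacent :: "('v, 'e) cgraph \<Rightarrow> 'e set \<Rightarrow> ('v \<times> 'v) set" where
  "adjacent G F \<equiv> {(u, w). \<exists>f\<in>F. u \<in> ends G f \<and> w \<in> ends G f}"

lemma linked_refl [simp]: "(u, u) \<in> linked G F"
  by (simp add: linked_def)

lemma sym_linked: "sym (linked G F)"
  unfolding linked_def by (intro sym_rtrancl symI) auto

lemma linked_sym: "(u, w) \<in> linked G F \<Longrightarrow> (w, u) \<in> linked G F"
  using sym_linked by (metis symD)

lemma linked_trans [trans]: "(u, w) \<in> linked G F \<Longrightarrow> (w, z) \<in> linked G F \<Longrightarrow> (u, z) \<in> linked G F"
  unfolding linked_def by (rule rtrancl_trans)

lemma equiv_linked: "equiv UNIV (linked G F)"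
proof (rule equivI)
  show "trans (linked G F)" unfolding linked_def by (rule trans_rtrancl)
qed (auto simp: sym_linked refl_on_def)

lemma linked_edge: "f \<in> F \<Longrightarrow> u \<in> ends G f \<Longrightarrow> w \<in> ends G f \<Longrightarrow> (u, w) \<in> linked G F"
  unfolding linked_def by (rule r_into_rtrancl) auto

lemma linked_mono: "F \<subseteq> F' \<Longrightarrow> linked G F \<subseteq> linked G F'"
  unfolding linked_def by (rule rtrancl_mono) blast

text \<open>Saturating classes of the finer relation gives the map between quotients by which
  components are compared when edges are added.\<close>

lemma linked_Image_linked:
  assumes "F \<subseteq> F'"
  shows "linked G F' `` (linked G F `` {u}) = linked G F' `` {u}"
  using linked_mono[OF assms, of G] linked_trans[of u _ G F'] linked_refl[of u G F] by blast

lemma linked_induct [consumes 1, case_names refl step]: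
  assumes "(u, w) \<in> linked G F" "P u"
    and "\<And>a b f. (u, a) \<in> linked G F \<Longrightarrow> P a \<Longrightarrow> f \<in> F \<Longrightarrow> a \<in> ends G f \<Longrightarrow> b \<in> ends G f \<Longrightarrow> P b"
  shows "P w"
  using assms(1) unfolding linked_def
proof (induction rule: rtrancl_induct)
  case base then show ?case by (rule assms(2))
next
  case (step a b)
  then show ?case using assms(3)[of a] by (auto simp: linked_def)
qed

text \<open>A walk cannot leave its first edge. This determines which vertices a contraction
  identifies, as the contracted edges at a time have disjoint ends.\<close>

lemma linked_disjoint_iff:
  assumes "\<And>f g. f \<in> F \<Longrightarrow> g \<in> F \<Longrightarrow> f \<noteq> g \<Longrightarrow> ends G f \<inter> ends G g = {}"
  shows "(u, w) \<in> linked G F \<longleftrightarrow> u = w \<or> (\<exists>f\<in>F. u \<in> ends G f \<and> w \<in> ends G f)" (is "_ \<longleftrightarrow> ?R w")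
proof
  assume "(u, w) \<in> linked G F"
  then show "?R w"
    by (induction rule: linked_induct) (use assms in \<open>blast+\<close>)
next
  assume "?R w" then show "(u, w) \<in> linked G F" using linked_edge by fastforce
qed

lemma linked_merged: "(u, merged G F u) \<in> linked G F"
  unfolding merged_def by (rule someI[of _ u]) simp

text \<open>\<open>SOME\<close> is applied to the same predicate throughout a class. Later arguments
  use only this kernel and the fact that a vertex is linked to its representative.\<close>

lemma merged_eq_iff: "merged G F u = merged G F w \<longleftrightarrow> (u, w) \<in> linked G F"
proof
  assume "merged G F u = merged G F w"
  then show "(u, w) \<in> linked G F"
    by (metis linked_merged linked_sym linked_trans)
next
  assume a: "(u, w) \<in> linked G F"
  have "(u, z) \<in> linked G F \<longleftrightarrow> (w, z) \<in> linked G F" for z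
    using a by (meson linked_sym linked_trans)
  then show "merged G F u = merged G F w" unfolding merged_def by simp
qed

lemma verts_contract [simp]: "verts (contract_edges G F) = merged G F ` verts G"
  and edges_contract [simp]: "edges (contract_edges G F) = edges G - F"
  and ends_contract [simp]: "ends (contract_edges G F) f = merged G F ` ends G f"
  and col_contract [simp]: "col (contract_edges G F) = col G"
  by (simp_all add: contract_edges_def)

text \<open>Edges keep their names, so a walk in the contraction lifts edge by edge; the jumps
  between a vertex and its representative are bridged inside \<open>C\<close>.\<close>

lemma linked_contract_iff:
  "(merged G C u, merged G C w) \<in> linked (contract_edges G C) F \<longleftrightarrow> (u, w) \<in> linked G (F \<union> C)"
proof
  have *: "(z, merged G C z) \<in> linked G (F \<union> C)" for z
    using linked_merged linked_mono[of C "F \<union> C"] by fastforce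
  assume "(merged G C u, merged G C w) \<in> linked (contract_edges G C) F"
  then have "(merged G C u, merged G C w) \<in> linked G (F \<union> C)"
  proof (induction rule: linked_induct)
    case (step a b f)
    then obtain a' b' where "a = merged G C a'" "b = merged G C b'" "a' \<in> ends G f" "b' \<in> ends G f"
      by auto
    then have "(a, b) \<in> linked G (F \<union> C)"
      using linked_trans[OF linked_sym[OF *] linked_trans[OF linked_edge *]] step.hyps by blast
    with step.IH show ?case by (rule linked_trans)
  qed simp
  from linked_trans[OF * linked_trans[OF this linked_sym[OF *]]]
  show "(u, w) \<in> linked G (F \<union> C)" .
next
  assume "(u, w) \<in> linked G (F \<union> C)"
  then show "(merged G C u, merged G C w) \<in> linked (contract_edges G C) F"
  proof (induction rule: linked_induct)
    case (step a b f)
    show ?case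
    proof (cases "f \<in> C")
      case True
      then have "merged G C a = merged G C b"
        using step.hyps by (auto simp: merged_eq_iff intro: linked_edge)
      then show ?thesis using step by simp
    next
      case False
      then have "f \<in> F" using step by auto
      then have "(merged G C a, merged G C b) \<in> linked (contract_edges G C) F"
        using step by (auto intro!: linked_edge)
      with step.IH show ?thesis by (rule linked_trans)
    qed
  qed simp
qed

text \<open>Here \<open>m\<close> may identify points of \<open>A\<close>; by reflexivity of
  \<open>R'\<close> such points are already \<open>R\<close>-related, so no classes are
  lost.\<close>

lemma card_quotient_image:
  assumes "equiv UNIV R" "equiv UNIV R'"
    and "\<And>u w. u \<in> A \<Longrightarrow> w \<in> A \<Longrightarrow> (m u, m w) \<in> R' \<longleftrightarrow> (u, w) \<in> R"
  shows "card ((m ` A) // R') = card (A // R)"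
proof -
  \<comment> \<open>Taking the union over all members of \<open>X\<close> avoids choosing a
    representative; on a class of \<open>R\<close> its terms coincide.\<close>
  define h where "h X = (\<Union>u\<in>X \<inter> A. R' `` {m u})" for X
  have h: "h (R `` {u}) = R' `` {m u}" if "u \<in> A" for u
  proof -
    have "R' `` {m w} = R' `` {m u}" if "w \<in> R `` {u} \<inter> A" for w
      using that \<open>u \<in> A\<close> assms by (metis IntE ImageE equiv_class_eq singletonD)
    moreover have "u \<in> R `` {u} \<inter> A" using that assms(1) by (auto simp: equiv_def refl_on_def)
    ultimately show ?thesis unfolding h_def by blast
  qed
  have "bij_betw h (A // R) ((m ` A) // R')"
  proof (rule bij_betw_imageI)
    show "inj_on h (A // R)"
    proof (rule inj_onI)
      fix X Y assume "X \<in> A // R" "Y \<in> A // R" "h X = h Y"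
      then obtain u w where "u \<in> A" "w \<in> A" "X = R `` {u}" "Y = R `` {w}" by (auto elim!: quotientE)
      moreover from this have "(m u, m w) \<in> R'" using \<open>h X = h Y\<close> h assms(2)
        by (metis UNIV_I eq_equiv_class)
      ultimately show "X = Y" using assms by (metis equiv_class_eq)
    qed
    show "h ` (A // R) = (m ` A) // R'"
      using h by (fastforce simp: quotient_def)
  qed
  then show ?thesis by (metis bij_betw_same_card)
qed

text \<open>Isolates count whatever \<open>F\<close> is: an isolate takes the place of a vertex that
  carries only a green loop.\<close>

definition comps :: "('v, 'e) cgraph \<Rightarrow> 'e set \<Rightarrow> nat" where
  "comps G F = card (verts G // linked G F) + card (isolates G)"

text \<open>The hypothesis keeps isolates out of \<open>C\<close>; contracting one would merely
  remove it and lose a component.\<close>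

lemma comps_contract:
  assumes "\<And>f. f \<in> C \<Longrightarrow> ends G f \<noteq> {}"
  shows "comps (contract_edges G C) F = comps G (F \<union> C)"
proof -
  have "isolates (contract_edges G C) = isolates G" using assms by (auto simp: isolates_def)
  moreover have "card (verts (contract_edges G C) // linked (contract_edges G C) F)
      = card (verts G // linked G (F \<union> C))"
    unfolding verts_contract
    by (rule card_quotient_image) (auto simp: equiv_linked linked_contract_iff)
  ultimately show ?thesis by (simp add: comps_def)
qed

lemma comps_insert_eq:
  assumes "\<And>u w. u \<in> ends G f \<Longrightarrow> w \<in> ends G f \<Longrightarrow> (u, w) \<in> linked G F"
  shows "comps G (insert f F) = comps G F"
proof -
  have "linked G (insert f F) = linked G F"
  proof
    show "linked G (insert f F) \<subseteq> linked G F"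
    proof (rule subrelI)
      fix u w assume "(u, w) \<in> linked G (insert f F)"
      then show "(u, w) \<in> linked G F"
      proof (induction rule: linked_induct)
        case (step a b g)
        then have "(a, b) \<in> linked G F" using assms linked_edge[of g F] by auto
        with step.IH show ?case by (rule linked_trans)
      qed simp
    qed
  qed (simp add: linked_mono subset_insertI)
  then show ?thesis by (simp add: comps_def)
qed

lemma comps_antimono:
  assumes "finite (verts G)" "F \<subseteq> F'"
  shows "comps G F' \<le> comps G F"
proof -
  have "verts G // linked G F' = (\<lambda>X. linked G F' `` X) ` (verts G // linked G F)"
    by (simp add: quotient_def image_UN linked_Image_linked[OF assms(2)])
  moreover have "finite (verts G // linked G F)"
    using assms by (simp add: quotient_def)
  ultimately show ?thesis using card_image_le by (simp add: comps_def)
qed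

text \<open>The new edge can only join the components of \<open>p\<close> and \<open>q\<close>. With
  the component of \<open>q\<close> left out, saturation is injective on the others.\<close>

lemma comps_insert_le:
  assumes "finite (verts G)" "ends G f = {p, q}"
  shows "comps G F \<le> comps G (insert f F) + 1"
proof -
  let ?R = "linked G F" and ?R' = "linked G (insert f F)"
  \<comment> \<open>After its last passage through \<open>f\<close> a walk runs in \<open>F\<close>
    and starts at \<open>p\<close> or \<open>q\<close>.\<close>
  have keep: "(u, w) \<in> ?R \<or> (p, w) \<in> ?R \<or> (q, w) \<in> ?R" if "(u, w) \<in> ?R'" for u w
    using that
  proof (induction rule: linked_induct)
    case (step a b g)
    show ?case
    proof (cases "g = f")
      case True
      then show ?thesis using step assms(2) by auto
    next
      case False
      then have "(a, b) \<in> ?R" using step linked_edge[of g F] by auto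
      then show ?thesis using step.IH linked_trans[of _ a G F b] by blast
    qed
  qed simp
  have im: "?R' `` (?R `` {z}) = ?R' `` {z}" for z
    by (rule linked_Image_linked) auto
  have "inj_on (\<lambda>X. ?R' `` X) (verts G // ?R - {?R `` {q}})"
  proof (rule inj_onI)
    fix X Y assume X: "X \<in> verts G // ?R - {?R `` {q}}" and Y: "Y \<in> verts G // ?R - {?R `` {q}}"
      and eq: "?R' `` X = ?R' `` Y"
    obtain u w where uw: "X = ?R `` {u}" "Y = ?R `` {w}" using X Y by (auto elim!: quotientE)
    have cl: "?R `` {a} = ?R `` {b}" if "(a, b) \<in> ?R" for a b
      using that equiv_linked by (metis equiv_class_eq)
    have "(u, w) \<in> ?R'" using eq linked_refl[of w G "insert f F"] unfolding uw im by blast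
    then have "(w, u) \<in> ?R'" by (rule linked_sym)
    then have 1: "(w, u) \<in> ?R \<or> (p, u) \<in> ?R \<or> (q, u) \<in> ?R" by (rule keep)
    have 2: "(u, w) \<in> ?R \<or> (p, w) \<in> ?R \<or> (q, w) \<in> ?R" using \<open>(u, w) \<in> ?R'\<close> by (rule keep)
    have "(q, u) \<notin> ?R" "(q, w) \<notin> ?R" using X Y cl unfolding uw by auto
    then show "X = Y" using 1 2 cl unfolding uw by metis
  qed
  then have "card (verts G // ?R - {?R `` {q}}) = card ((\<lambda>X. ?R' `` X) ` (verts G // ?R - {?R `` {q}}))"
    by (simp add: card_image)
  also have "\<dots> \<le> card (verts G // ?R')"
  proof (rule card_mono)
    show "finite (verts G // ?R')" using assms by (simp add: quotient_def)
    show "(\<lambda>X. ?R' `` X) ` (verts G // ?R - {?R `` {q}}) \<subseteq> verts G // ?R'"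
      using im by (auto simp: quotient_def)
  qed
  finally show ?thesis unfolding comps_def
    using card_Diff1_le[of "verts G // ?R"] by (simp add: card_Diff_singleton_if split: if_splits)
qed

lemma comps_union_le:
  assumes "finite (verts G)" "finite D" "\<And>f. f \<in> D \<Longrightarrow> \<exists>p q. ends G f = {p, q}"
  shows "comps G F \<le> comps G (F \<union> D) + card D"
  using assms(2,3)
proof (induction D rule: finite_induct)
  case (insert f D)
  obtain p q where "ends G f = {p, q}" using insert by blast
  then have "comps G (F \<union> D) \<le> comps G (insert f (F \<union> D)) + 1"
    using assms(1) comps_insert_le by metis
  then show ?case using insert by simp
qed simp


subsection \<open>Degrees under contraction\<close>

text \<open>Incidences push forward along the merging: an edge with both ends in one fibre becomes a
  loop there and counts 2 on either side.\<close>

lemma incidence_contract: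
  assumes "finite (verts G)" "ends G f \<subseteq> verts G" "card (ends G f) \<le> 2"
  shows "incidence (contract_edges G C) f a = (\<Sum>u | u \<in> verts G \<and> merged G C u = a. incidence G f u)"
proof -
  have "finite (ends G f)" using assms finite_subset by blast
  from this assms(3) show ?thesis
  proof (cases rule: card_le_2_cases)
    case 1 then show ?thesis by (simp add: incidence_empty)
  next
    case (2 p q)
    let ?X = "{u. u \<in> verts G \<and> merged G C u = a}"
    have *: "(\<Sum>u\<in>?X. of_bool (u = z) :: nat) = of_bool (a = merged G C z)" if "z \<in> verts G" for z
      using assms(1) that by (auto simp: of_bool_def)
    have "p \<in> verts G" "q \<in> verts G" using 2 assms(2) by auto
    then have "(\<Sum>u\<in>?X. incidence G f u) = of_bool (a = merged G C p) + of_bool (a = merged G C q)"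
      by (simp only: incidence_pair[OF 2] sum.distrib *)
    also have "\<dots> = incidence (contract_edges G C) f a"
      using incidence_pair[of "contract_edges G C" f "merged G C p" "merged G C q"] 2 by simp
    finally show ?thesis by simp
  qed
qed

text \<open>The share of the contracted edges stands on the left because subtraction on
  \<open>nat\<close> is truncated.\<close>

lemma cdegree_contract:
  assumes "finite (verts G)" "finite (edges G)" "C \<subseteq> edges G"
    and "\<And>f. f \<in> edges G \<Longrightarrow> ends G f \<subseteq> verts G \<and> card (ends G f) \<le> 2"
  shows "cdegree (contract_edges G C) c a
      + (\<Sum>f | f \<in> C \<and> col G f = c. \<Sum>u | u \<in> verts G \<and> merged G C u = a. incidence G f u)
    = (\<Sum>u | u \<in> verts G \<and> merged G C u = a. cdegree G c u)"
proof -
  let ?X = "{u. u \<in> verts G \<and> merged G C u = a}"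
  have "(\<Sum>u\<in>?X. cdegree G c u) = (\<Sum>f | f \<in> edges G \<and> col G f = c. \<Sum>u\<in>?X. incidence G f u)"
    unfolding cdegree_def by (rule sum.swap)
  also have "{f. f \<in> edges G \<and> col G f = c} =
      {f. f \<in> edges G - C \<and> col G f = c} \<union> {f. f \<in> C \<and> col G f = c}"
    using assms(3) by auto
  also have "(\<Sum>f\<in>\<dots>. \<Sum>u\<in>?X. incidence G f u) =
      (\<Sum>f | f \<in> edges G - C \<and> col G f = c. \<Sum>u\<in>?X. incidence G f u)
      + (\<Sum>f | f \<in> C \<and> col G f = c. \<Sum>u\<in>?X. incidence G f u)"
    using assms(2,3) by (intro sum.union_disjoint) (auto intro: finite_subset)
  also have "(\<Sum>f | f \<in> edges G - C \<and> col G f = c. \<Sum>u\<in>?X. incidence G f u)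
      = cdegree (contract_edges G C) c a"
    unfolding cdegree_def using assms(1,4) by (intro sum.cong) (auto simp: incidence_contract)
  finally show ?thesis by simp
qed

text \<open>By disjointness the fibre of the merged vertex is \<open>{p, q}\<close>, and
  \<open>f\<close> is the only edge of \<open>C\<close> that meets it, once at each end; hence the
  2.\<close>

lemma cdegree_contract_link:
  assumes "finite (verts G)" "finite (edges G)" "C \<subseteq> edges G"
    and "\<And>f. f \<in> edges G \<Longrightarrow> ends G f \<subseteq> verts G \<and> card (ends G f) \<le> 2"
    and disj: "\<And>f g. f \<in> C \<Longrightarrow> g \<in> C \<Longrightarrow> f \<noteq> g \<Longrightarrow> ends G f \<inter> ends G g = {}"
    and f: "f \<in> C" "ends G f = {p, q}" "p \<noteq> q"
  shows "cdegree (contract_edges G C) c (merged G C p) + 2 * of_bool (col G f = c)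
    = cdegree G c p + cdegree G c q"
proof -
  have X: "{u. u \<in> verts G \<and> merged G C u = merged G C p} = {p, q}"
  proof -
    have "(u, p) \<in> linked G C \<longleftrightarrow> u = p \<or> (\<exists>g\<in>C. u \<in> ends G g \<and> p \<in> ends G g)" for u
      by (rule linked_disjoint_iff) (rule disj)
    moreover have "g = f" if "g \<in> C" "p \<in> ends G g" for g
      using disj[of g f] f that by auto
    ultimately have "merged G C u = merged G C p \<longleftrightarrow> u \<in> {p, q}" for u
      using f by (auto simp: merged_eq_iff)
    moreover have "{p, q} \<subseteq> verts G" using assms(3,4) f by (metis subset_eq)
    ultimately show ?thesis by auto
  qed
  have "(\<Sum>g | g \<in> C \<and> col G g = c. incidence G g p + incidence G g q)
      = (\<Sum>g | g \<in> C \<and> col G g = c. if g = f then 2 else 0)"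
  proof (rule sum.cong)
    fix g assume g: "g \<in> {g. g \<in> C \<and> col G g = c}"
    show "incidence G g p + incidence G g q = (if g = f then 2 else 0)"
    proof (cases "g = f")
      case True then show ?thesis using f by (simp add: incidence_pair)
    next
      case False
      then have "p \<notin> ends G g" "q \<notin> ends G g" using disj[of g f] f g by auto
      then have "incidence G g p = 0" "incidence G g q = 0" by (simp_all add: incidence_eq_0)
      then show ?thesis using False by simp
    qed
  qed simp
  also have "\<dots> = 2 * of_bool (col G f = c)"
    using f(1) finite_subset[OF assms(3,2)] by simp
  finally show ?thesis
    using cdegree_contract[OF assms(1-4), of c "merged G C p"] f(3) unfolding X by simp
qed

lemma cdegree_contract_untouched:
  assumes "finite (verts G)" "finite (edges G)" "C \<subseteq> edges G"
    and "\<And>f. f \<in> edges G \<Longrightarrow> ends G f \<subseteq> verts G \<and> card (ends G f) \<le> 2"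
    and disj: "\<And>f g. f \<in> C \<Longrightarrow> g \<in> C \<Longrightarrow> f \<noteq> g \<Longrightarrow> ends G f \<inter> ends G g = {}"
    and v: "v \<in> verts G" "\<And>f. f \<in> C \<Longrightarrow> v \<notin> ends G f"
  shows "cdegree (contract_edges G C) c (merged G C v) = cdegree G c v"
proof -
  have "(u, v) \<in> linked G C \<longleftrightarrow> u = v \<or> (\<exists>g\<in>C. u \<in> ends G g \<and> v \<in> ends G g)" for u
    by (rule linked_disjoint_iff) (rule disj)
  then have X: "{u. u \<in> verts G \<and> merged G C u = merged G C v} = {v}"
    using v by (auto simp: merged_eq_iff)
  have "(\<Sum>g | g \<in> C \<and> col G g = c. incidence G g v) = 0"
    by (rule sum.neutral) (use v in \<open>auto simp: incidence_eq_0\<close>)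
  then show ?thesis
    using cdegree_contract[OF assms(1-4), of c "merged G C v"] unfolding X by simp
qed

section \<open>Transport of cycles along a renaming of vertices\<close>

text \<open>Being a cycle depends only on the ends of the edges of \<open>C\<close>, up to a
  renaming that is injective on the vertices of \<open>C\<close>; elsewhere \<open>m\<close> may
  identify vertices, as contractions do.\<close>

lemma is_cycle_cong:
  assumes "C \<subseteq> edges G" "C \<subseteq> edges G'"
    and e: "\<And>f. f \<in> C \<Longrightarrow> ends G' f = m ` ends G f"
    and inj: "inj_on m (\<Union>(ends G ` C))"
  shows "is_cycle G' C \<longleftrightarrow> is_cycle G C"
proof -
  define V where "V = \<Union>(ends G ` C)"
  have V': "\<Union>(ends G' ` C) = m ` V" using e by (auto simp: V_def)
  have inj: "inj_on m V" using inj by (simp add: V_def)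
  have VI: "u \<in> V" if "f \<in> C" "u \<in> ends G f" for f u using that by (auto simp: V_def)
  have L: "(m u, m w) \<in> linked G' C \<longleftrightarrow> (u, w) \<in> linked G C" if "u \<in> V" "w \<in> V" for u w
  proof
    assume "(u, w) \<in> linked G C"
    then show "(m u, m w) \<in> linked G' C"
    proof (induction rule: linked_induct)
      case (step a b f)
      then have "(m a, m b) \<in> linked G' C" using e by (auto intro!: linked_edge)
      with step.IH show ?case by (rule linked_trans)
    qed simp
  next
    assume "(m u, m w) \<in> linked G' C"
    \<comment> \<open>A walk in \<open>G'\<close> is not known to run through images of given
      vertices, so the induction carries a preimage \<open>z\<close> of the current vertex;
      injectivity identifies \<open>z\<close> with \<open>w\<close> at the end.\<close>
    then have "\<exists>z\<in>V. m z = m w \<and> (u, z) \<in> linked G C"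
    proof (induction rule: linked_induct)
      case refl show ?case by (rule bexI[of _ u]) (use \<open>u \<in> V\<close> in simp_all)
    next
      case (step a b f)
      then obtain z where z: "z \<in> V" "m z = a" "(u, z) \<in> linked G C" by auto
      obtain a' b' where ab: "a = m a'" "b = m b'" "a' \<in> ends G f" "b' \<in> ends G f"
        using step.hyps e by auto
      then have "z = a'" using z inj VI[OF step.hyps(2)] by (auto dest: inj_onD)
      then have "(u, b') \<in> linked G C" using z(3) ab step.hyps
        by (meson linked_edge linked_trans)
      moreover have "b' \<in> V" using ab VI step.hyps by blast
      ultimately show ?case using ab by blast
    qed
    then obtain z where "z \<in> V" "m z = m w" "(u, z) \<in> linked G C" by auto
    then show "(u, w) \<in> linked G C" using inj that by (metis inj_onD)
  qed
  have D: "degree (G'\<lparr>edges := C\<rparr>) (m v) = degree (G\<lparr>edges := C\<rparr>) v" if v: "v \<in> V" for v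
  proof -
    have "m v \<in> ends G' f \<longleftrightarrow> v \<in> ends G f" if "f \<in> C" for f
      using that e v inj VI by (auto dest: inj_onD)
    moreover have "ends G' f = {m v} \<longleftrightarrow> ends G f = {v}" if "f \<in> C" for f
    proof -
      have "m ` ends G f = m ` {v} \<longleftrightarrow> ends G f = {v}"
        using inj_on_image_eq_iff[OF inj, of "ends G f" "{v}"] VI[OF that] v by auto
      then show ?thesis using e[OF that] by simp
    qed
    ultimately show ?thesis by (simp add: degree_def cong: conj_cong)
  qed
  show ?thesis unfolding is_cycle_def V' V_def[symmetric]
    using assms(1,2) e by (simp add: L D)
qed

subsection \<open>Partially reduced gehms\<close>

definition greens :: "('v, 'e) cgraph \<Rightarrow> 'e set" where
  "greens G = {f \<in> edges G. col G f = Green}"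

definition nongreens :: "('v, 'e) cgraph \<Rightarrow> 'e set" where
  "nongreens G = {f \<in> edges G. col G f \<noteq> Green}"

text \<open>Hyperfaces and hypervertices both live in the green edges plus one further colour.
  Keeping all green edges in the count makes it invariant under suppression, which alters green
  edges only.\<close>

definition kappa :: "('v, 'e) cgraph \<Rightarrow> 'e set \<Rightarrow> nat" where
  "kappa G M = comps G (M \<union> greens G)"

text \<open>The graphs that occur while degree-two vertices are being suppressed. Contracting a link at such
  a vertex gives the merged vertex the colour degrees of the other end.\<close>

definition semi_gehm :: "('v, 'e) cgraph \<Rightarrow> bool" where
  "semi_gehm G \<longleftrightarrow>
     finite (verts G) \<and> finite (edges G) \<and>
     (\<forall>f\<in>edges G. ends G f \<subseteq> verts G \<and> card (ends G f) \<le> 2 \<and> (ends G f = {} \<longrightarrow> col G f = Green)) \<and>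
     (\<forall>v\<in>verts G. (\<forall>c. cdegree G c v = 1) \<or> (\<forall>c. cdegree G c v = (if c = Green then 2 else 0)))"

lemma cdegree_no_loops:
  assumes "finite (edges G)" "\<And>f. f \<in> edges G \<Longrightarrow> ends G f \<noteq> {v}"
  shows "cdegree G c v = card {f \<in> edges G. col G f = c \<and> v \<in> ends G f}"
proof -
  have "cdegree G c v = (\<Sum>f | f \<in> edges G \<and> col G f = c. of_bool (v \<in> ends G f))"
    unfolding cdegree_def incidence_def using assms(2) by (intro sum.cong) auto
  also have "\<dots> = card ({f. f \<in> edges G \<and> col G f = c} \<inter> {f. v \<in> ends G f})"
    using assms(1) by (simp add: sum.If_cases of_bool_def)
  also have "{f. f \<in> edges G \<and> col G f = c} \<inter> {f. v \<in> ends G f}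
      = {f \<in> edges G. col G f = c \<and> v \<in> ends G f}" by auto
  finally show ?thesis .
qed

section \<open>Gehms in terms of colour degrees\<close>

lemma gehm_ends_subset: "gehm H \<Longrightarrow> f \<in> edges H \<Longrightarrow> ends H f \<subseteq> verts H"
  by (simp add: gehm_def)

lemma gehm_ends_ne_singleton:
  assumes "gehm H" "f \<in> edges H"
  shows "ends H f \<noteq> {v}"
  using assms by (force simp: gehm_def isolates_def)

text \<open>Proper colouring bounds each of the three colour degrees by 1, and they add up to
  3.\<close>

lemma gehm_cdegree:
  assumes "gehm H" "v \<in> verts H"
  shows "cdegree H c v = 1"
proof -
  have fin: "finite (edges H)" using assms by (simp add: gehm_def)
  have le: "cdegree H c v \<le> 1" for c
  proof -
    have "f = g" if "f \<in> edges H" "g \<in> edges H" "v \<in> ends H f" "v \<in> ends H g" "col H f = col H g" for f g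
      using that assms(1) unfolding gehm_def by blast
    then have "card {f \<in> edges H. col H f = c \<and> v \<in> ends H f} \<le> 1"
      using fin by (auto simp: card_le_Suc0_iff_eq)
    then show ?thesis
      using cdegree_no_loops[OF fin gehm_ends_ne_singleton[OF assms(1)]] by simp
  qed
  have "degree H v = 3" using assms by (simp add: gehm_def)
  then have "cdegree H Blue v + cdegree H Green v + cdegree H Red v = 3"
    using degree_sum_cdegree[OF fin, of v] by simp
  then have "cdegree H Blue v = 1 \<and> cdegree H Green v = 1 \<and> cdegree H Red v = 1"
    using le[of Blue] le[of Green] le[of Red] by linarith
  then show ?thesis by (cases c) auto
qed

lemma gehm_incident:
  assumes H: "gehm H" and v: "v \<in> verts H"
  obtains f where "f \<in> edges H" "col H f = c" "v \<in> ends H f"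
proof -
  have "\<exists>f\<in>edges H. col H f = c \<and> v \<in> ends H f"
  proof (rule ccontr)
    assume "\<not> ?thesis"
    then have "cdegree H c v = 0"
      unfolding cdegree_def by (intro sum.neutral) (auto simp: incidence_eq_0)
    then show False using gehm_cdegree[OF H v, of c] by simp
  qed
  then show thesis using that by blast
qed

lemma gehm_edge_unique:
  "\<lbrakk>gehm H; f \<in> edges H; g \<in> edges H; col H f = col H g; v \<in> ends H f; v \<in> ends H g\<rbrakk> \<Longrightarrow> f = g"
  unfolding gehm_def by blast

lemma gehm_edge_cases:
  assumes "gehm H" "f \<in> edges H"
  obtains "ends H f = {}" "col H f = Green" | p q where "ends H f = {p, q}" "p \<noteq> q" "p \<in> verts H" "q \<in> verts H"
proof -
  have "card (ends H f) = 2 \<or> f \<in> isolates H" "ends H f \<subseteq> verts H" using assms by (auto simp: gehm_def)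
  then show ?thesis using that by (auto simp: isolates_def card_2_iff)
qed

lemma gehm_semi_gehm: "gehm H \<Longrightarrow> semi_gehm H"
  unfolding semi_gehm_def by (auto simp: gehm_cdegree) (auto simp: gehm_def isolates_def)

text \<open>Without vertices of degree two all colour degrees are 1, while a loop, or two edges of
  one colour at a vertex, would force a colour degree of at least 2.\<close>

lemma semi_gehm_gehm:
  assumes "semi_gehm G" "\<And>v. v \<in> verts G \<Longrightarrow> degree G v \<noteq> 2"
  shows "gehm G"
proof -
  have fin: "finite (verts G)" "finite (edges G)" using assms by (auto simp: semi_gehm_def)
  have one: "cdegree G c v = 1" if "v \<in> verts G" for c v
    using assms that degree_sum_cdegree[OF fin(2), of v] unfolding semi_gehm_def by fastforce
  have deg3: "degree G v = 3" if "v \<in> verts G" for v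
    using one[OF that] degree_sum_cdegree[OF fin(2), of v] by simp
  have e: "ends G f \<subseteq> verts G" "card (ends G f) \<le> 2" "ends G f = {} \<Longrightarrow> col G f = Green"
    if "f \<in> edges G" for f
    using assms(1) that by (auto simp: semi_gehm_def)
  have ends: "card (ends G f) = 2 \<or> f \<in> isolates G" if f: "f \<in> edges G" for f
  proof -
    have "finite (ends G f)" using e(1)[OF f] fin finite_subset by blast
    from this e(2)[OF f] show ?thesis
    proof (cases rule: card_le_2_cases)
      case 1 then show ?thesis using e(3)[OF f] f by (simp add: isolates_def)
    next
      case (2 p q)
      then have "incidence G f p \<le> 1"
        using incidence_le_cdegree[OF fin(2) f, of p] one[of p] e(1)[OF f] by auto
      then have "p \<noteq> q" using incidence_pair[OF 2, of p] by auto
      then show ?thesis using 2 by simp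
    qed
  qed
  have "col G f \<noteq> col G g" if "f \<in> edges G" "g \<in> edges G" "f \<noteq> g" "v \<in> ends G f" "v \<in> ends G g" for f g v
  proof
    assume "col G f = col G g"
    moreover have "v \<in> verts G" using e(1) that by blast
    ultimately have "incidence G f v + incidence G g v \<le> 1"
      using incidence_add_le_cdegree[OF fin(2) that(1-3), of v] one[of v] by simp
    then show False using that(4,5) by (simp add: incidence_def)
  qed
  then show ?thesis unfolding gehm_def using fin deg3 ends e(1) by blast
qed

section \<open>Suppression as a reduction\<close>

text \<open>All that is remembered of a suppression, whose outcome depends on choices. Cycles are
  tracked only among non-green edges, for hyperedges; hyperfaces and hypervertices are tracked
  through \<open>kappa\<close>.\<close>

definition reduces_to :: "('v, 'e) cgraph \<Rightarrow> ('v, 'e) cgraph \<Rightarrow> bool" where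
  "reduces_to G G' \<longleftrightarrow>
     semi_gehm G' \<and> col G' = col G \<and> nongreens G' = nongreens G \<and>
     (\<forall>M\<subseteq>nongreens G. kappa G' M = kappa G M) \<and>
     (\<forall>C\<subseteq>nongreens G. is_cycle G' C \<longleftrightarrow> is_cycle G C)"

lemma reduces_to_trans: "reduces_to G G' \<Longrightarrow> reduces_to G' G'' \<Longrightarrow> reduces_to G G''"
  unfolding reduces_to_def by simp

lemma quotient_insert: "insert v A // R = insert (R `` {v}) (A // R)"
  by (auto simp: quotient_def)

text \<open>The loop uses up both incidences at \<open>v\<close>, so \<open>{v}\<close> is a
  component whenever the green edges are present. It vanishes with \<open>v\<close> and comes back
  as the isolate \<open>l\<close>.\<close>

lemma reduces_to_suppress_loop:
  assumes "semi_gehm G" "v \<in> verts G" "degree G v = 2" and l: "l \<in> edges G" "ends G l = {v}"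
  defines "G' \<equiv> G\<lparr>verts := verts G - {v}, ends := (\<lambda>f. if ends G f = {v} then {} else ends G f)\<rparr>"
  shows "reduces_to G G'"
proof -
  have sel [simp]: "verts G' = verts G - {v}" "edges G' = edges G" "col G' = col G"
      "ends G' f = (if ends G f = {v} then {} else ends G f)" for f
    by (simp_all add: G'_def)
  have fin: "finite (verts G)" "finite (edges G)" using assms by (auto simp: semi_gehm_def)
  have vG: "cdegree G c v = (if c = Green then 2 else 0)" for c
    using assms(1-3) degree_sum_cdegree[OF fin(2), of v] unfolding semi_gehm_def by fastforce
  have lG: "col G l = Green" using incidence_le_cdegree[OF fin(2) l(1), of v] l
    by (auto simp: vG incidence_def split: if_splits)
  have only: "f = l" if "f \<in> edges G" "v \<in> ends G f" for f
  proof (rule ccontr)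
    assume ne: "f \<noteq> l"
    have "col G f = Green"
      using incidence_le_cdegree[OF fin(2) that(1), of v] that(2)
      by (auto simp: vG incidence_def split: if_splits)
    then have "incidence G f v + incidence G l v \<le> 2"
      using incidence_add_le_cdegree[OF fin(2) that(1) l(1) ne, of v] lG vG by simp
    then show False using that(2) l by (simp add: incidence_def split: if_splits)
  qed
  have inc: "incidence G' f u = incidence G f u" if "u \<noteq> v" for f u
    using that by (auto simp: incidence_def)
  have semi: "semi_gehm G'"
  proof -
    have "cdegree G' c u = cdegree G c u" if "u \<noteq> v" for c u
      by (simp add: cdegree_def inc[OF that])
    moreover have "ends G' f \<subseteq> verts G' \<and> card (ends G' f) \<le> 2 \<and> (ends G' f = {} \<longrightarrow> col G' f = Green)"
      if f: "f \<in> edges G" for f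
    proof (cases "f = l")
      case True then show ?thesis using l lG by simp
    next
      case False
      then have "v \<notin> ends G f" using only f by blast
      then show ?thesis using assms(1) f by (auto simp: semi_gehm_def)
    qed
    ultimately show ?thesis using assms(1) unfolding semi_gehm_def by simp
  qed
  \<comment> \<open>A loop contributes only the pair of \<open>v\<close> with itself, which the
    reflexive closure contains anyway.\<close>
  have linked': "linked G' F = linked G F" for F
  proof -
    have "adjacent G F \<subseteq> (adjacent G' F)\<^sup>*"
    proof (rule subrelI)
      fix a b assume "(a, b) \<in> adjacent G F"
      then obtain f where f: "f \<in> F" "a \<in> ends G f" "b \<in> ends G f" by auto
      show "(a, b) \<in> (adjacent G' F)\<^sup>*"
      proof (cases "a = b")
        case False
        then have "ends G f \<noteq> {v}" using f by auto
        then show ?thesis using f by (intro r_into_rtrancl) auto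
      qed simp
    qed
    moreover have "adjacent G' F \<subseteq> adjacent G F" by (auto split: if_splits)
    ultimately show ?thesis unfolding linked_def by (metis (no_types, lifting) rtrancl_subset)
  qed
  have kappa': "kappa G' M = kappa G M" if M: "M \<subseteq> nongreens G" for M
  proof -
    let ?F = "M \<union> greens G" let ?R = "linked G ?F"
    have "l \<in> ?F" using lG l by (simp add: greens_def)
    have Rv: "(v, u) \<in> ?R \<longleftrightarrow> u = v" for u
    proof
      assume "(v, u) \<in> ?R"
      then show "u = v"
      proof (induction rule: linked_induct)
        case (step a b f)
        then have "f \<in> edges G" using M by (auto simp: greens_def nongreens_def)
        then have "f = l" using only step.hyps(3) step.IH by simp
        then show ?case using step.hyps(4) l by simp
      qed simp
    qed simp
    have "verts G // ?R = insert {v} ((verts G - {v}) // ?R)"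
    proof -
      have "?R `` {v} = {v}" using Rv by auto
      moreover have "verts G = insert v (verts G - {v})" using assms(2) by auto
      ultimately show ?thesis by (metis quotient_insert)
    qed
    moreover have "{v} \<notin> (verts G - {v}) // ?R"
    proof
      assume "{v} \<in> (verts G - {v}) // ?R"
      then obtain u where "u \<noteq> v" "?R `` {u} = {v}" by (auto elim!: quotientE)
      then show False using linked_refl[of u G ?F] by blast
    qed
    ultimately have "card (verts G // ?R) = card ((verts G - {v}) // ?R) + 1"
      using fin by (simp add: quotient_def)
    moreover have "isolates G' = insert l (isolates G)" "l \<notin> isolates G"
    proof -
      have "ends G f = {v} \<longleftrightarrow> f = l" if "f \<in> edges G" for f using only[OF that] l by blast
      then show "isolates G' = insert l (isolates G)" using l lG by (auto simp: isolates_def)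
    qed (use l in \<open>simp add: isolates_def\<close>)
    moreover have "finite (isolates G)" using fin by (simp add: isolates_def)
    ultimately show ?thesis by (simp add: kappa_def comps_def linked' greens_def)
  qed
  have "is_cycle G' C = is_cycle G C" if "C \<subseteq> nongreens G" for C
  proof (rule is_cycle_cong[where m = id])
    fix f assume "f \<in> C"
    then have "f \<in> edges G" "f \<noteq> l" using that lG by (auto simp: nongreens_def)
    then have "ends G f \<noteq> {v}" using only[of f] by blast
    then show "ends G' f = id ` ends G f" by simp
  qed (use that in \<open>auto simp: nongreens_def\<close>)
  then show ?thesis unfolding reduces_to_def using semi kappa' by (simp add: nongreens_def)
qed

text \<open>All edges at \<open>v\<close> are green. So the contracted edge belongs to every set
  counted by \<open>kappa\<close>, and no non-green edge ends at \<open>v\<close>, which makes the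
  merging of \<open>v\<close> with \<open>w\<close> injective on non-green cycles.\<close>

lemma reduces_to_suppress_link:
  assumes "semi_gehm G" "v \<in> verts G" "degree G v = 2"
    and "\<And>f. f \<in> edges G \<Longrightarrow> ends G f \<noteq> {v}" and f: "f \<in> edges G" "v \<in> ends G f"
  shows "reduces_to G (contract_edges G {f})" and "card (verts (contract_edges G {f})) < card (verts G)"
proof -
  let ?G = "contract_edges G {f}" and ?m = "merged G {f}"
  have fin: "finite (verts G)" "finite (edges G)" using assms by (auto simp: semi_gehm_def)
  have e: "ends G g \<subseteq> verts G \<and> card (ends G g) \<le> 2" "ends G g = {} \<Longrightarrow> col G g = Green"
    if "g \<in> edges G" for g
    using assms(1) that by (auto simp: semi_gehm_def)
  have vG: "cdegree G c v = (if c = Green then 2 else 0)" for c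
    using assms(1-3) degree_sum_cdegree[OF fin(2), of v] unfolding semi_gehm_def by fastforce
  have green: "col G g = Green" if "g \<in> edges G" "v \<in> ends G g" for g
    using incidence_le_cdegree[OF fin(2) that(1), of v] that(2)
    by (auto simp: vG incidence_def split: if_splits)
  obtain w where w: "ends G f = {v, w}" "v \<noteq> w"
  proof -
    have "finite (ends G f)" "card (ends G f) \<le> 2" using e[OF f(1)] fin finite_subset by blast+
    then show thesis
    proof (cases rule: card_le_2_cases)
      case 1 then show ?thesis using f by simp
    next
      case (2 p q)
      then show ?thesis using f assms(4)[OF f(1)] that by (metis insert_iff insert_commute insert_absorb2 singletonD)
    qed
  qed
  have wv: "w \<in> verts G" using e(1)[OF f(1)] w by auto
  have linked1: "(u, z) \<in> linked G {f} \<longleftrightarrow> u = z \<or> u \<in> {v, w} \<and> z \<in> {v, w}" for u z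
    by (subst linked_disjoint_iff) (use w in auto)
  have deg_vw: "cdegree ?G c (?m v) = cdegree G c w" for c
    using cdegree_contract_link[of G "{f}" f v w c] fin f e w vG[of c] green[OF f]
    by (auto split: if_splits)
  have deg_other: "cdegree ?G c (?m u) = cdegree G c u" if "u \<in> verts G" "u \<notin> {v, w}" for c u
    by (rule cdegree_contract_untouched) (use fin f e w that in auto)
  have mvw: "?m w = ?m v" by (simp add: merged_eq_iff linked1)
  have semi: "semi_gehm ?G"
  proof -
    have "(\<forall>c. cdegree ?G c a = 1) \<or> (\<forall>c. cdegree ?G c a = (if c = Green then 2 else 0))"
      if "a \<in> verts ?G" for a
    proof -
      obtain u where u: "u \<in> verts G" "a = ?m u" using \<open>a \<in> verts ?G\<close> by auto
      show ?thesis
      proof (cases "u \<in> {v, w}")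
        case True
        then have "a = ?m v" using u mvw by auto
        then show ?thesis using assms(1) wv deg_vw unfolding semi_gehm_def by simp
      next
        case False
        then show ?thesis using assms(1) u deg_other unfolding semi_gehm_def by simp
      qed
    qed
    moreover have "card (ends ?G g) \<le> 2" if "g \<in> edges G" for g
      using e(1)[OF that] fin finite_subset[of "ends G g"] card_image_le[of "ends G g" ?m] by force
    moreover have "ends ?G g \<subseteq> verts ?G" if "g \<in> edges G" for g
      using e(1)[OF that] by auto
    ultimately show ?thesis unfolding semi_gehm_def using fin e(2) by simp
  qed
  have kappa': "kappa ?G M = kappa G M" if M: "M \<subseteq> nongreens G" for M
  proof -
    have "kappa ?G M = comps G (M \<union> greens ?G \<union> {f})"
      unfolding kappa_def by (rule comps_contract) (use w in auto)
    also have "M \<union> greens ?G \<union> {f} = M \<union> greens G"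
      using f green by (auto simp: greens_def)
    finally show ?thesis by (simp add: kappa_def)
  qed
  have ng: "nongreens ?G = nongreens G" using f green by (auto simp: nongreens_def)
  have "is_cycle ?G C = is_cycle G C" if "C \<subseteq> nongreens G" for C
  proof (rule is_cycle_cong[where m = ?m])
    show "inj_on ?m (\<Union> (ends G ` C))"
    proof (rule inj_onI)
      fix u z assume "u \<in> \<Union> (ends G ` C)" "z \<in> \<Union> (ends G ` C)" and uz: "?m u = ?m z"
      then have "u \<noteq> v" "z \<noteq> v" using green that by (auto simp: nongreens_def)
      then show "u = z" using uz by (auto simp: merged_eq_iff linked1)
    qed
    show "C \<subseteq> edges ?G" "C \<subseteq> edges G" using that ng by (auto simp: nongreens_def)
  qed simp
  then show "reduces_to G ?G" unfolding reduces_to_def using semi kappa' ng by simp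
  have "?m v \<in> ?m ` (verts G - {v})" using mvw[symmetric] wv w by simp
  then have "?m ` verts G = ?m ` (verts G - {v})" by blast
  then have "card (verts ?G) \<le> card (verts G - {v})" using fin card_image_le[of "verts G - {v}" ?m] by simp
  then show "card (verts ?G) < card (verts G)"
    using assms(2) fin card_Diff1_less[of "verts G" v] by linarith
qed

lemma suppress_vertex_step:
  assumes "semi_gehm G" "v \<in> verts G" "degree G v = 2"
  shows "reduces_to G (suppress_vertex G v) \<and> card (verts (suppress_vertex G v)) < card (verts G)"
proof (cases "\<exists>f\<in>edges G. ends G f = {v}")
  case True
  then show ?thesis
    using reduces_to_suppress_loop[OF assms] assms(2) card_Diff1_less[of "verts G" v] assms(1)
    by (auto simp: suppress_vertex_def semi_gehm_def)
next
  case False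
  let ?f = "SOME f. f \<in> edges G \<and> v \<in> ends G f"
  have "finite (edges G)" using assms(1) by (simp add: semi_gehm_def)
  then have "(\<Sum>f\<in>edges G. incidence G f v) \<noteq> 0"
    using assms(3) degree_sum_incidence by fastforce
  then have "\<exists>f. f \<in> edges G \<and> v \<in> ends G f"
    using sum.neutral[of "edges G" "\<lambda>f. incidence G f v"] by (auto simp: incidence_eq_0)
  then have "?f \<in> edges G \<and> v \<in> ends G ?f" by (rule someI_ex)
  then show ?thesis
    using reduces_to_suppress_link[OF assms, of ?f] False by (auto simp: suppress_vertex_def)
qed

text \<open>Each step loses a vertex, so the loop terminates whatever \<open>SOME\<close> picks,
  with \<open>reduces_to G\<close> as invariant.\<close>

lemma suppress_reduces_to:
  assumes "semi_gehm G"
  shows "reduces_to G (suppress G) \<and> gehm (suppress G)"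
proof -
  let ?b = "\<lambda>G :: ('a, 'b) cgraph. \<exists>v\<in>verts G. degree G v = 2"
  let ?v = "\<lambda>G :: ('a, 'b) cgraph. SOME v. v \<in> verts G \<and> degree G v = 2"
  have v: "?v G' \<in> verts G' \<and> degree G' (?v G') = 2" if "?b G'" for G'
  proof -
    have "\<exists>v. v \<in> verts G' \<and> degree G' v = 2" using that by blast
    then show ?thesis by (rule someI_ex)
  qed
  have "reduces_to G (suppress G) \<and> \<not> ?b (suppress G)"
    unfolding suppress_def
  proof (rule while_rule[where P = "reduces_to G" and r = "measure (\<lambda>G. card (verts G))"])
    show "reduces_to G G" using assms by (simp add: reduces_to_def)
  next
    fix G' assume G': "reduces_to G G'" "?b G'"
    then have "semi_gehm G'" by (simp add: reduces_to_def)
    from suppress_vertex_step[OF this conjunct1[OF v[OF G'(2)]] conjunct2[OF v[OF G'(2)]]]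
    show "reduces_to G (suppress_vertex G' (?v G'))"
      using reduces_to_trans[OF G'(1)] by simp
  next
    fix G' assume G': "reduces_to G G'" "?b G'"
    then have "semi_gehm G'" by (simp add: reduces_to_def)
    from suppress_vertex_step[OF this conjunct1[OF v[OF G'(2)]] conjunct2[OF v[OF G'(2)]]]
    show "(suppress_vertex G' (?v G'), G') \<in> measure (\<lambda>G. card (verts G))"
      by simp
  qed auto
  moreover from this have "semi_gehm (suppress G)" by (simp add: reduces_to_def)
  ultimately show ?thesis using semi_gehm_gehm by blast
qed


subsection \<open>Deleting and contracting unions of hyperedges\<close>

text \<open>\<open>c\<close> is the deleted colour and \<open>c'\<close> the contracted one.
  Deletion and contraction of hyperedges differ only by exchanging blue and red, so one analysis
  serves both.\<close>

definition delete_contract :: "('v, 'e) cgraph \<Rightarrow> 'e set \<Rightarrow> colour \<Rightarrow> colour \<Rightarrow> ('v, 'e) cgraph" where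
  "delete_contract H U c c' =
     contract_edges (delete_edges H {f \<in> U. col H f = c}) {f \<in> U. col H f = c'}"

text \<open>In a gehm these are exactly the unions of hyperedges.\<close>

definition saturated :: "('v, 'e) cgraph \<Rightarrow> 'e set \<Rightarrow> bool" where
  "saturated H U \<longleftrightarrow> U \<subseteq> nongreens H \<and>
     (\<forall>f\<in>U. \<forall>g\<in>nongreens H. ends H f \<inter> ends H g \<noteq> {} \<longrightarrow> g \<in> U)"

text \<open>Merging the ends of a \<open>c'\<close>-edge of \<open>U\<close> leaves a vertex with
  two green incidences and nothing else. Vertices off \<open>U\<close> keep their degrees, and by
  saturation the remaining non-green edges stay clear of all merged vertices.\<close>

lemma delete_contract_reduction:
  assumes H: "gehm H" and U: "saturated H U"
    and c: "{c, c'} = {Blue, Red}" "c \<noteq> c'"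
  defines "G \<equiv> delete_contract H U c c'"
  shows "semi_gehm G" "col G = col H" "nongreens G = nongreens H - U"
    and "\<And>M. kappa G M = kappa H (M \<union> {f \<in> U. col H f = c'})"
    and "\<And>C. C \<subseteq> nongreens H - U \<Longrightarrow> is_cycle G C \<longleftrightarrow> is_cycle H C"
proof -
  define D where "D = {f \<in> U. col H f = c}"
  define K where "K = {f \<in> U. col H f = c'}"
  define G0 where "G0 = delete_edges H D"
  have G: "G = contract_edges G0 K" by (simp add: G_def delete_contract_def G0_def D_def K_def)
  have sel [simp]: "verts G0 = verts H" "edges G0 = edges H - D" "ends G0 = ends H" "col G0 = col H"
    by (simp_all add: G0_def delete_edges_def)
  have fin: "finite (verts H)" "finite (edges H)" using H by (auto simp: gehm_def)
  have UE: "U \<subseteq> edges H" "\<And>f. f \<in> U \<Longrightarrow> col H f \<noteq> Green"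
    using U by (auto simp: saturated_def nongreens_def)
  have cd: "c = Blue \<and> c' = Red \<or> c = Red \<and> c' = Blue"
    using c by (auto simp: doubleton_eq_iff)
  then have cG: "c \<noteq> Green" "c' \<noteq> Green" by auto
  have Ucol: "col H f = c \<or> col H f = c'" if "f \<in> U" for f
    using UE(2)[OF that] cd by (cases "col H f") auto
  have UDK: "U = D \<union> K" "D \<inter> K = {}" using Ucol c(2) by (auto simp: D_def K_def)
  have KE: "K \<subseteq> edges G0" using UE UDK by auto
  have e0: "ends G0 f \<subseteq> verts G0 \<and> card (ends G0 f) \<le> 2" if "f \<in> edges G0" for f
    using gehm_semi_gehm[OF H] that by (simp add: semi_gehm_def)
  have disj: "ends G0 f \<inter> ends G0 g = {}" if "f \<in> K" "g \<in> K" "f \<noteq> g" for f g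
  proof -
    have "f \<in> edges H" "g \<in> edges H" "col H f = col H g" using that UE by (auto simp: K_def)
    then show ?thesis using gehm_edge_unique[OF H, of f g] that(3) by auto
  qed
  \<comment> \<open>Saturation: at a vertex touched by \<open>U\<close> both non-green edges belong
    to \<open>U\<close>, so \<open>U\<close>, \<open>D\<close> and \<open>K\<close> touch the same
    vertices.\<close>
  have other: "\<exists>g\<in>U. col H g = d \<and> v \<in> ends H g"
    if f: "f \<in> U" "v \<in> ends H f" and d: "d \<noteq> Green" for f v d
  proof -
    have "v \<in> verts H" using gehm_ends_subset[OF H] f UE(1) by blast
    then obtain g where g: "g \<in> edges H" "col H g = d" "v \<in> ends H g" by (rule gehm_incident[OF H])
    then show ?thesis using U f d unfolding saturated_def nongreens_def by blast
  qed
  have touch: "(\<exists>f\<in>U. v \<in> ends H f) \<longleftrightarrow> (\<exists>f\<in>K. v \<in> ends H f)"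
      "(\<exists>f\<in>U. v \<in> ends H f) \<longleftrightarrow> (\<exists>f\<in>D. v \<in> ends H f)" for v
    using other[OF _ _ cG(1)] other[OF _ _ cG(2)] unfolding D_def K_def by blast+
  have deg0: "cdegree G0 d v = (if d = c \<and> (\<exists>f\<in>U. v \<in> ends H f) then 0 else 1)"
    if v: "v \<in> verts H" for v d
  proof (cases "d = c \<and> (\<exists>f\<in>U. v \<in> ends H f)")
    case True
    then obtain f where f: "f \<in> D" "v \<in> ends H f" using touch by blast
    have "incidence G0 g v = 0" if "g \<in> {g. g \<in> edges G0 \<and> col G0 g = d}" for g
    proof -
      have "v \<notin> ends H g" using gehm_edge_unique[OF H, of f g v] that f True UE
        by (auto simp: D_def)
      then show ?thesis by (simp add: incidence_eq_0)
    qed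
    then show ?thesis using True unfolding cdegree_def by (simp add: sum.neutral)
  next
    case False
    have "cdegree G0 d v = cdegree H d v"
      unfolding cdegree_def
    proof (rule sum.mono_neutral_cong_left)
      show "\<forall>g\<in>{f. f \<in> edges H \<and> col H f = d} - {f. f \<in> edges G0 \<and> col G0 f = d}. incidence H g v = 0"
        using False UE by (auto simp: incidence_eq_0 D_def)
    qed (use fin in \<open>auto simp: incidence_def\<close>)
    then show ?thesis using False gehm_cdegree[OF H v] by simp
  qed
  show "semi_gehm G"
  proof -
    have "(\<forall>d. cdegree G d a = 1) \<or> (\<forall>d. cdegree G d a = (if d = Green then 2 else 0))"
      if "a \<in> verts G" for a
    proof -
      obtain v where v: "v \<in> verts H" "a = merged G0 K v"
        using \<open>a \<in> verts G\<close> by (auto simp: G)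
      show ?thesis
      proof (cases "\<exists>f\<in>U. v \<in> ends H f")
        case False
        then have "v \<notin> ends G0 f" if "f \<in> K" for f using that UDK(1) unfolding sel(3) by blast
        then have "cdegree G d a = cdegree G0 d v" for d
          unfolding G v(2) using fin KE e0 disj v(1) by (intro cdegree_contract_untouched) auto
        then show ?thesis using deg0[OF v(1)] False by simp
      next
        case True
        then obtain f where f: "f \<in> K" "v \<in> ends H f" using touch by blast
        have fE: "f \<in> edges H" using f UE UDK by blast
        obtain w where w: "ends H f = {v, w}" "v \<noteq> w" "w \<in> verts H"
          using f(2) by (cases rule: gehm_edge_cases[OF H fE]) auto
        have w': "\<exists>f\<in>U. w \<in> ends H f" using f(1) w(1) UDK by blast
        have colf: "col H f = c'" using f(1) by (simp add: K_def)
        have "cdegree G d a = (if d = Green then 2 else 0)" for d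
        proof -
          \<comment> \<open>Green gives 1 + 1; colour \<open>c'\<close> gives 1 + 1 less the 2 of
            \<open>f\<close>; colour \<open>c\<close> was deleted at both ends.\<close>
          have "cdegree G d a + 2 * of_bool (c' = d) = cdegree G0 d v + cdegree G0 d w"
            unfolding G v(2) colf[symmetric]
            using cdegree_contract_link[of G0 K f v w d] fin KE e0 disj f(1) w by simp
          also have "\<dots> = 2 * of_bool (d \<noteq> c)"
            using True w' by (simp add: deg0[OF v(1)] deg0[OF w(3)])
          finally show ?thesis using cd by (cases d; elim disjE conjE; simp)
        qed
        then show ?thesis by blast
      qed
    qed
    moreover have "card (ends G g) \<le> 2" "ends G g \<subseteq> verts G" "ends G g = {} \<Longrightarrow> col G g = Green"
      if "g \<in> edges G" for g
    proof -
      have g: "g \<in> edges H" using that by (simp add: G)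
      have eg: "ends H g \<subseteq> verts H" "card (ends H g) \<le> 2" "ends H g = {} \<Longrightarrow> col H g = Green"
        using gehm_semi_gehm[OF H] g by (auto simp: semi_gehm_def)
      have "finite (ends H g)" using eg(1) fin(1) finite_subset by blast
      then show "card (ends G g) \<le> 2"
        using card_image_le[of "ends H g" "merged G0 K"] eg(2) by (simp add: G)
      show "ends G g \<subseteq> verts G" using eg(1) by (auto simp: G)
      show "ends G g = {} \<Longrightarrow> col G g = Green" using eg(3) by (simp add: G)
    qed
    moreover have "finite (verts G)" "finite (edges G)" using fin by (simp_all add: G)
    ultimately show ?thesis unfolding semi_gehm_def by simp
  qed
  show "col G = col H" by (simp add: G)
  show "nongreens G = nongreens H - U" using UDK by (auto simp: G nongreens_def)
  show "kappa G M = kappa H (M \<union> {f \<in> U. col H f = c'})" for M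
  proof -
    have "ends G0 f \<noteq> {}" if f: "f \<in> K" for f
    proof -
      have "f \<in> edges H" "col H f \<noteq> Green" using f UE UDK by auto
      then show ?thesis using gehm_semi_gehm[OF H] by (auto simp: semi_gehm_def)
    qed
    then have "kappa G M = comps G0 (M \<union> greens G \<union> K)"
      unfolding kappa_def G by (rule comps_contract)
    also have "greens G = greens H" using UE UDK by (auto simp: greens_def G)
    also have "isolates G0 = isolates H" using UE UDK by (auto simp: isolates_def)
    then have "comps G0 F = comps H F" for F by (simp add: comps_def linked_def)
    finally show ?thesis by (simp add: kappa_def K_def Un_ac)
  qed
  show "is_cycle G C \<longleftrightarrow> is_cycle H C" if C: "C \<subseteq> nongreens H - U" for C
  proof (rule is_cycle_cong[where m = "merged G0 K"])
    show "inj_on (merged G0 K) (\<Union> (ends H ` C))"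
    proof (rule inj_onI)
      fix u z assume u: "u \<in> \<Union> (ends H ` C)" and "z \<in> \<Union> (ends H ` C)"
        and eq: "merged G0 K u = merged G0 K z"
      have "u \<notin> ends H f" if "f \<in> K" for f
        using u C U that UDK unfolding saturated_def by blast
      moreover have "(u, z) \<in> linked G0 K \<longleftrightarrow> u = z \<or> (\<exists>f\<in>K. u \<in> ends G0 f \<and> z \<in> ends G0 f)"
        by (rule linked_disjoint_iff) (rule disj)
      ultimately show "u = z" using eq by (auto simp: merged_eq_iff)
    qed
  qed (use C UDK in \<open>auto simp: G nongreens_def\<close>)
qed

lemma suppress_delete_contract:
  assumes H: "gehm H" and U: "saturated H U"
    and c: "{c, c'} = {Blue, Red}" "c \<noteq> c'"
  defines "G \<equiv> suppress (delete_contract H U c c')"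
  shows "gehm G" "col G = col H" "nongreens G = nongreens H - U"
    and "\<And>M. M \<subseteq> nongreens H - U \<Longrightarrow> kappa G M = kappa H (M \<union> {f \<in> U. col H f = c'})"
    and "\<And>C. C \<subseteq> nongreens H - U \<Longrightarrow> is_cycle G C \<longleftrightarrow> is_cycle H C"
  using suppress_reduces_to[OF delete_contract_reduction(1)[OF assms(1-4)]]
    delete_contract_reduction(2-)[OF assms(1-4)]
  unfolding G_def reduces_to_def by simp_all

subsection \<open>Cycles of a gehm\<close>

text \<open>A cycle has two edges at \<open>v\<close>. Their colours differ and only
  \<open>c\<close> and \<open>c'\<close> are available, so these are all the edges of colours
  \<open>c\<close> and \<open>c'\<close> at \<open>v\<close>.\<close>

lemma cycle_edges:
  assumes H: "gehm H" and C: "C \<in> cycles H c c'" and cc: "c \<noteq> c'"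
    and f: "f \<in> C" "v \<in> ends H f" and g: "g \<in> edges H" "col H g \<in> {c, c'}" "v \<in> ends H g"
  shows "g \<in> C"
proof -
  have fin: "finite (edges H)" using H by (simp add: gehm_def)
  have CE: "C \<subseteq> edges H" "col H ` C \<subseteq> {c, c'}" using C by (auto simp: cycles_def is_cycle_def)
  have "degree (H\<lparr>edges := C\<rparr>) v = 2" using C f by (auto simp: cycles_def is_cycle_def)
  moreover have "{f \<in> C. ends H f = {v}} = {}"
    using gehm_ends_ne_singleton[OF H] CE by blast
  ultimately have card: "card {f \<in> C. v \<in> ends H f} = 2" by (simp add: degree_def)
  have "inj_on (col H) {f \<in> edges H. v \<in> ends H f}"
    using H unfolding gehm_def inj_on_def by blast
  then have inj: "inj_on (col H) {f \<in> edges H. v \<in> ends H f \<and> col H f \<in> {c, c'}}"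
    by (rule inj_on_subset) auto
  have "{f \<in> C. v \<in> ends H f} = {f \<in> edges H. v \<in> ends H f \<and> col H f \<in> {c, c'}}"
  proof (rule card_seteq)
    show "card {f \<in> edges H. v \<in> ends H f \<and> col H f \<in> {c, c'}} \<le> card {f \<in> C. v \<in> ends H f}"
      unfolding card card_image[OF inj, symmetric]
      by (rule order.trans[OF card_mono[of "{c, c'}"]]) (use cc in auto)
  qed (use CE fin in auto)
  then show ?thesis using g by blast
qed

text \<open>Isolates are left out, as an edge without ends lies on no cycle.\<close>

definition two_coloured :: "('v, 'e) cgraph \<Rightarrow> colour \<Rightarrow> colour \<Rightarrow> 'e set" where
  "two_coloured H c c' = {f \<in> edges H. col H f \<in> {c, c'} \<and> ends H f \<noteq> {}}"

lemma cycle_subset: "C \<in> cycles H c c' \<Longrightarrow> C \<subseteq> two_coloured H c c'"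
  by (auto simp: cycles_def is_cycle_def two_coloured_def)

text \<open>By \<open>cycle_edges\<close> a walk along edges of the two colours never leaves the
  cycle.\<close>

lemma cycle_linked_class:
  assumes H: "gehm H" and C: "C \<in> cycles H c c'" and cc: "c \<noteq> c'" and u: "u \<in> \<Union>(ends H ` C)"
  shows "\<Union>(ends H ` C) = linked H (two_coloured H c c') `` {u}"
proof
  have "(u, w) \<in> linked H C" if "w \<in> \<Union>(ends H ` C)" for w
    using C u that by (auto simp: cycles_def is_cycle_def)
  then show "\<Union>(ends H ` C) \<subseteq> linked H (two_coloured H c c') `` {u}"
    using linked_mono[OF cycle_subset[OF C]] by blast
  show "linked H (two_coloured H c c') `` {u} \<subseteq> \<Union>(ends H ` C)"
  proof
    fix w assume "w \<in> linked H (two_coloured H c c') `` {u}"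
    then have "(u, w) \<in> linked H (two_coloured H c c')" by simp
    then show "w \<in> \<Union>(ends H ` C)"
    proof (induction rule: linked_induct)
      case (step a b f)
      then obtain g where "g \<in> C" "a \<in> ends H g" by blast
      then have "f \<in> C" using cycle_edges[OF H C cc, of g a f] step.hyps by (simp add: two_coloured_def)
      then show ?case using step.hyps by blast
    qed (rule u)
  qed
qed

lemma cycle_eq_class_edges:
  assumes H: "gehm H" and C: "C \<in> cycles H c c'" and cc: "c \<noteq> c'"
  shows "C = {f \<in> two_coloured H c c'. ends H f \<inter> \<Union>(ends H ` C) \<noteq> {}}"
proof
  show "C \<subseteq> {f \<in> two_coloured H c c'. ends H f \<inter> \<Union>(ends H ` C) \<noteq> {}}"
    using cycle_subset[OF C] by (auto simp: two_coloured_def)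
  show "{f \<in> two_coloured H c c'. ends H f \<inter> \<Union>(ends H ` C) \<noteq> {}} \<subseteq> C"
    using cycle_edges[OF H C cc] by (auto simp: two_coloured_def)
qed

text \<open>Every vertex has exactly one edge of each colour, so a component of the two-coloured
  subgraph is 2-regular.\<close>

lemma class_cycle:
  assumes H: "gehm H" and cc: "c \<noteq> c'" and v: "v \<in> verts H"
  defines "X \<equiv> linked H (two_coloured H c c') `` {v}"
  defines "C \<equiv> {f \<in> two_coloured H c c'. ends H f \<inter> X \<noteq> {}}"
  shows "C \<in> cycles H c c'" "\<Union>(ends H ` C) = X"
proof -
  let ?P = "two_coloured H c c'"
  have PE: "?P \<subseteq> edges H" by (auto simp: two_coloured_def)
  have fin: "finite (edges H)" using H by (simp add: gehm_def)
  have CP: "C \<subseteq> ?P" by (auto simp: C_def)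
  have EV: "ends H f \<subseteq> verts H" if "f \<in> edges H" for f using H that by (simp add: gehm_def)
  have XV: "X \<subseteq> verts H"
  proof
    fix w assume "w \<in> X"
    then have "(v, w) \<in> linked H ?P" by (simp add: X_def)
    then show "w \<in> verts H" by (induction rule: linked_induct) (use v EV PE in auto)
  qed
  have closed: "ends H f \<subseteq> X" if "f \<in> C" for f
  proof
    fix w assume "w \<in> ends H f"
    moreover obtain u where "u \<in> ends H f" "(v, u) \<in> linked H ?P"
      using \<open>f \<in> C\<close> by (auto simp: C_def X_def)
    moreover have "f \<in> ?P" using \<open>f \<in> C\<close> CP by blast
    ultimately show "w \<in> X"
      using linked_trans[of v u H ?P w] linked_edge[of f ?P u H w] by (simp add: X_def)
  qed
  show V: "\<Union>(ends H ` C) = X"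
  proof
    show "X \<subseteq> \<Union>(ends H ` C)"
    proof
      fix w assume "w \<in> X"
      moreover from this obtain f where "f \<in> edges H" "col H f = c" "w \<in> ends H f"
        using gehm_incident[OF H, of w c] XV by blast
      ultimately show "w \<in> \<Union>(ends H ` C)" unfolding C_def two_coloured_def by blast
    qed
  qed (use closed in auto)
  have conn: "(v, w) \<in> linked H C" if "w \<in> X" for w
  proof -
    have "(v, w) \<in> linked H ?P" using that by (simp add: X_def)
    then show ?thesis
    proof (induction rule: linked_induct)
      case (step a b f)
      then have "f \<in> C" unfolding C_def X_def by blast
      then show ?case using step linked_edge linked_trans by metis
    qed simp
  qed
  have deg: "degree (H\<lparr>edges := C\<rparr>) w = 2" if w: "w \<in> X" for w
  proof -
    obtain f where f: "f \<in> edges H" "col H f = c" "w \<in> ends H f"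
      using gehm_incident[OF H, of w c] w XV by blast
    obtain g where g: "g \<in> edges H" "col H g = c'" "w \<in> ends H g"
      using gehm_incident[OF H, of w c'] w XV by blast
    have "h = f \<or> h = g" if "h \<in> C" "w \<in> ends H h" for h
    proof -
      have "h \<in> edges H" "col H h \<in> {c, c'}" using that CP by (auto simp: two_coloured_def)
      then show ?thesis
        using gehm_edge_unique[OF H _ f(1), of h w] gehm_edge_unique[OF H _ g(1), of h w] f g that by auto
    qed
    moreover have "f \<in> C" "g \<in> C" using f g w unfolding C_def two_coloured_def by auto
    ultimately have "{h \<in> C. w \<in> ends H h} = {f, g}" using f g by auto
    moreover have "f \<noteq> g" using f g cc by auto
    moreover have "card {h \<in> C. ends H h = {w}} = 0"
    proof -
      have "{h \<in> C. ends H h = {w}} = {}" using gehm_ends_ne_singleton[OF H] CP PE by blast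
      then show ?thesis by (simp only: card.empty)
    qed
    ultimately show ?thesis by (simp add: degree_def)
  qed
  have "v \<in> X" by (simp add: X_def)
  then have "C \<noteq> {}" using V by auto
  have "(u, w) \<in> linked H C" if "u \<in> X" "w \<in> X" for u w
    using linked_trans[OF linked_sym[OF conn] conn] that by blast
  moreover have "ends H f \<noteq> {}" "f \<in> edges H" "col H f \<in> {c, c'}" if "f \<in> C" for f
    using that CP by (auto simp: two_coloured_def)
  ultimately show "C \<in> cycles H c c'"
    unfolding cycles_def is_cycle_def V mem_Collect_eq image_subset_iff using \<open>C \<noteq> {}\<close> deg by blast
qed

text \<open>A cycle is recovered from its vertex set, and these vertex sets are the two-coloured
  components.\<close>

lemma card_cycles:
  assumes H: "gehm H" and cc: "c \<noteq> c'"
  shows "card (cycles H c c') = card (verts H // linked H (two_coloured H c c'))"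
proof -
  let ?R = "linked H (two_coloured H c c')"
  have "bij_betw (\<lambda>C. \<Union>(ends H ` C)) (cycles H c c') (verts H // ?R)"
  proof (rule bij_betw_imageI)
    show "inj_on (\<lambda>C. \<Union>(ends H ` C)) (cycles H c c')"
    proof (rule inj_onI)
      fix C C' assume C: "C \<in> cycles H c c'" "C' \<in> cycles H c c'"
        and eq: "\<Union>(ends H ` C) = \<Union>(ends H ` C')"
      show "C = C'"
        using cycle_eq_class_edges[OF H C(1) cc] cycle_eq_class_edges[OF H C(2) cc]
        unfolding eq by simp
    qed
    show "(\<lambda>C. \<Union>(ends H ` C)) ` cycles H c c' = verts H // ?R"
    proof (intro equalityI subsetI)
      fix X assume "X \<in> (\<lambda>C. \<Union>(ends H ` C)) ` cycles H c c'"
      then obtain C where C: "C \<in> cycles H c c'" "X = \<Union>(ends H ` C)" by auto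
      then obtain f where f: "f \<in> C" "f \<in> edges H" "ends H f \<noteq> {}" by (auto simp: cycles_def is_cycle_def)
      then obtain u where u: "u \<in> ends H f" by blast
      then have "X = ?R `` {u}" using cycle_linked_class[OF H C(1) cc, of u] C(2) f by blast
      moreover have "u \<in> verts H" using H f u by (auto simp: gehm_def)
      ultimately show "X \<in> verts H // ?R" by (simp add: quotientI)
    next
      fix X assume "X \<in> verts H // ?R"
      then obtain v where "v \<in> verts H" "X = ?R `` {v}" by (auto elim!: quotientE)
      then show "X \<in> (\<lambda>C. \<Union>(ends H ` C)) ` cycles H c c'"
        using class_cycle[OF H cc, of v] by (intro image_eqI) auto
    qed
  qed
  then show ?thesis by (rule bij_betw_same_card)
qed

text \<open>Singletons of isolates are not cycles, so the two counts add as in \<open>comps\<close>;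
  for \<open>linked\<close> isolates are invisible because they have no ends.\<close>

lemma card_cycles_isolates:
  assumes H: "gehm H" and c: "c \<noteq> Green"
  shows "card (cycles H c Green \<union> {{i} | i. i \<in> isolates H}) = kappa H {f \<in> edges H. col H f = c}"
proof -
  have fin: "finite (edges H)" using H by (simp add: gehm_def)
  have "cycles H c Green \<subseteq> Pow (edges H)" by (auto simp: cycles_def is_cycle_def)
  then have "finite (cycles H c Green)" using fin finite_subset by blast
  moreover have I: "{{i} | i. i \<in> isolates H} = (\<lambda>i. {i}) ` isolates H" by auto
  moreover have "finite (isolates H)" using fin by (simp add: isolates_def)
  moreover have "cycles H c Green \<inter> (\<lambda>i. {i}) ` isolates H = {}"
    by (auto simp: cycles_def is_cycle_def isolates_def)
  ultimately have "card (cycles H c Green \<union> {{i} | i. i \<in> isolates H})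
      = card (cycles H c Green) + card (isolates H)"
    unfolding I by (subst card_Un_disjoint) (auto simp: card_image)
  moreover have "linked H ({f \<in> edges H. col H f = c} \<union> greens H) = linked H (two_coloured H c Green)"
  proof -
    have "adjacent H ({f \<in> edges H. col H f = c} \<union> greens H) = adjacent H (two_coloured H c Green)"
      by (auto simp: greens_def two_coloured_def)
    then show ?thesis by (simp add: linked_def)
  qed
  ultimately show ?thesis using card_cycles[OF H c] by (simp add: kappa_def comps_def)
qed

lemma num_f_kappa: "gehm H \<Longrightarrow> num_f H = kappa H {f \<in> edges H. col H f = Blue}"
  using card_cycles_isolates[of H Blue] by (simp add: num_f_def hyperfaces_def)

lemma num_v_kappa: "gehm H \<Longrightarrow> num_v H = kappa H {f \<in> edges H. col H f = Red}"
proof -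
  assume "gehm H"
  moreover have "cycles H Green Red = cycles H Red Green" by (simp add: cycles_def insert_commute)
  ultimately show ?thesis using card_cycles_isolates[of H Red] by (simp add: num_v_def hypervertices_def)
qed


lemma cycles_disjoint:
  assumes H: "gehm H" and cc: "c \<noteq> c'" and C: "C \<in> cycles H c c'" "C' \<in> cycles H c c'"
    and f: "f \<in> C" "f \<in> C'"
  shows "C = C'"
proof -
  have "ends H f \<noteq> {}" using C(1) f(1) by (auto simp: cycles_def is_cycle_def)
  then obtain u where "u \<in> ends H f" by blast
  then have "u \<in> \<Union>(ends H ` C)" "u \<in> \<Union>(ends H ` C')" using f by auto
  then have eq: "\<Union>(ends H ` C) = \<Union>(ends H ` C')"
    using cycle_linked_class[OF H C(1) cc] cycle_linked_class[OF H C(2) cc] by simp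
  show ?thesis
    using cycle_eq_class_edges[OF H C(1) cc] cycle_eq_class_edges[OF H C(2) cc] unfolding eq by simp
qed

section \<open>Hyperedges partition the non-green edges\<close>

text \<open>In this form hyperedges are expressed by the data that reductions preserve.\<close>

lemma hyperedges_iff: "C \<in> hyperedges G \<longleftrightarrow> C \<subseteq> nongreens G \<and> is_cycle G C"
proof -
  have "k \<in> {Blue, Red} \<longleftrightarrow> k \<noteq> Green" for k by (cases k) auto
  then show ?thesis
    unfolding hyperedges_def cycles_def nongreens_def mem_Collect_eq image_subset_iff
    by (auto simp: is_cycle_def)
qed

lemma Union_hyperedges:
  assumes H: "gehm H"
  shows "\<Union>(hyperedges H) = nongreens H"
proof
  show "\<Union>(hyperedges H) \<subseteq> nongreens H" by (auto simp: hyperedges_iff)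
  show "nongreens H \<subseteq> \<Union>(hyperedges H)"
  proof
    fix f assume f: "f \<in> nongreens H"
    then have fE: "f \<in> edges H" "col H f \<noteq> Green" by (auto simp: nongreens_def)
    obtain v where v: "v \<in> ends H f" "v \<in> verts H"
      by (rule gehm_edge_cases[OF H fE(1)]) (use fE(2) in auto)
    have "f \<in> two_coloured H Blue Red"
      using fE v by (cases "col H f") (auto simp: two_coloured_def)
    then have "f \<in> {f \<in> two_coloured H Blue Red. ends H f \<inter> linked H (two_coloured H Blue Red) `` {v} \<noteq> {}}"
      using v(1) linked_refl[of v H "two_coloured H Blue Red"] by blast
    then show "f \<in> \<Union>(hyperedges H)"
      using class_cycle(1)[OF H _ v(2), of Blue Red] unfolding hyperedges_def by blast
  qed
qed

lemma finite_hyperedges: "gehm H \<Longrightarrow> finite (hyperedges H)"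
  by (rule finite_subset[of _ "Pow (edges H)"])
    (auto simp: hyperedges_def cycles_def is_cycle_def gehm_def)

lemma hyperedges_disjoint:
  "\<lbrakk>gehm H; e \<in> hyperedges H; e' \<in> hyperedges H; f \<in> e; f \<in> e'\<rbrakk> \<Longrightarrow> e = e'"
  unfolding hyperedges_def by (rule cycles_disjoint[of H Blue Red]) auto

lemma saturated_Union:
  assumes H: "gehm H" and S: "S \<subseteq> hyperedges H"
  shows "saturated H (\<Union>S)"
  unfolding saturated_def
proof (intro conjI ballI impI)
  show "\<Union>S \<subseteq> nongreens H" using S Union_hyperedges[OF H] by blast
  fix f g assume f: "f \<in> \<Union>S" and g: "g \<in> nongreens H" and fg: "ends H f \<inter> ends H g \<noteq> {}"
  obtain e where e: "e \<in> S" "f \<in> e" using f by blast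
  obtain v where v: "v \<in> ends H f" "v \<in> ends H g" using fg by blast
  have "g \<in> edges H" "col H g \<in> {Blue, Red}"
    using g by (cases "col H g"; auto simp: nongreens_def)+
  then have "g \<in> e"
    using cycle_edges[OF H _ _ e(2) v(1) _ _ v(2), of Blue Red] e(1) S
    unfolding hyperedges_def by blast
  then show "g \<in> \<Union>S" using e by blast
qed

lemma hyperedges_suppress_delete_contract:
  assumes H: "gehm H" and S: "S \<subseteq> hyperedges H"
    and c: "{c, c'} = {Blue, Red}" "c \<noteq> c'"
  shows "hyperedges (suppress (delete_contract H (\<Union>S) c c')) = hyperedges H - S" (is "hyperedges ?G = _")
proof (intro set_eqI)
  note red = suppress_delete_contract[OF H saturated_Union[OF H S] c]
  fix C
  have "C \<in> hyperedges ?G \<longleftrightarrow> C \<subseteq> nongreens H - \<Union>S \<and> is_cycle H C"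
    unfolding hyperedges_iff red(3) using red(5) by blast
  also have "\<dots> \<longleftrightarrow> C \<in> hyperedges H \<and> C \<inter> \<Union>S = {}"
    unfolding hyperedges_iff by blast
  \<comment> \<open>Hyperedges are nonempty and pairwise disjoint, so avoiding the union of
    \<open>S\<close> means not being a member.\<close>
  also have "\<dots> \<longleftrightarrow> C \<in> hyperedges H - S"
  proof (cases "C \<in> hyperedges H")
    case True
    then have "C \<noteq> {}" by (auto simp: hyperedges_iff is_cycle_def)
    then have "C \<inter> \<Union>S = {} \<longleftrightarrow> C \<notin> S"
      using hyperedges_disjoint[OF H True] S by blast
    then show ?thesis using True by simp
  qed simp
  finally show "C \<in> hyperedges ?G \<longleftrightarrow> C \<in> hyperedges H - S" .
qed

text \<open>The number of hyperfaces after deleting \<open>S\<close>, read off in \<open>H\<close> itself.\<close>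

definition twist :: "('v, 'e) cgraph \<Rightarrow> 'e set set \<Rightarrow> nat" where
  "twist H S = kappa H ({f \<in> edges H. col H f = Blue \<and> f \<notin> \<Union>S} \<union> {f \<in> \<Union>S. col H f = Red})"

lemma delete_hyperedges_eq: "delete_hyperedges H S = suppress (delete_contract H (\<Union>S) Blue Red)"
  by (simp add: delete_hyperedges_def delete_contract_def edges_of_def)

lemma contract_hyperedge_eq: "contract_hyperedge H e = suppress (delete_contract H (\<Union>{e}) Red Blue)"
  unfolding contract_hyperedge_def delete_contract_def edges_of_def ..

lemma coloured_edges_nongreens:
  "d \<noteq> Green \<Longrightarrow> {f \<in> edges G. col G f = d} = {f \<in> nongreens G. col G f = d}"
  by (auto simp: nongreens_def)

text \<open>\<open>kappa\<close> adds the contracted red edges of \<open>S\<close> back. In the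
  count of hypervertices this restores all red edges; in that of hyperfaces it puts red edges where
  the blue ones of \<open>S\<close> were deleted. The last claim lets deletions be composed without
  identifying graphs.\<close>

lemma delete_hyperedges:
  assumes H: "gehm H" and S: "S \<subseteq> hyperedges H"
  defines "G \<equiv> delete_hyperedges H S"
  shows "gehm G" "hyperedges G = hyperedges H - S"
    and "num_v G = num_v H" "num_f G = twist H S"
    and "\<And>S'. S' \<subseteq> hyperedges H - S \<Longrightarrow> twist G S' = twist H (S \<union> S')"
proof -
  have c: "{Blue, Red} = {Blue, Red}" "Blue \<noteq> Red" by auto
  note red = suppress_delete_contract[OF H saturated_Union[OF H S] c,
      folded delete_hyperedges_eq, folded G_def]
  show G: "gehm G" by (rule red)
  show "hyperedges G = hyperedges H - S"
    using hyperedges_suppress_delete_contract[OF H S c] by (simp add: G_def delete_hyperedges_eq)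
  have SU: "\<Union>S \<subseteq> nongreens H" using S Union_hyperedges[OF H] by blast
  have colG: "{f \<in> edges G. col G f = d} = {f \<in> nongreens H - \<Union>S. col H f = d}" if "d \<noteq> Green" for d
    using coloured_edges_nongreens[OF that, of G] by (simp add: red(2,3))
  have "num_v G = kappa G {f \<in> nongreens H - \<Union>S. col H f = Red}"
    using num_v_kappa[OF G] colG[of Red] by simp
  also have "\<dots> = kappa H ({f \<in> nongreens H - \<Union>S. col H f = Red} \<union> {f \<in> \<Union>S. col H f = Red})"
    by (rule red(4)) auto
  also have "{f \<in> nongreens H - \<Union>S. col H f = Red} \<union> {f \<in> \<Union>S. col H f = Red} = {f \<in> edges H. col H f = Red}"
    using SU by (auto simp: nongreens_def)
  finally show "num_v G = num_v H" using num_v_kappa[OF H] by simp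
  show tw: "twist G S' = twist H (S \<union> S')" if S': "S' \<subseteq> hyperedges H - S" for S'
  proof -
    have S'U: "\<Union>S' \<subseteq> nongreens H - \<Union>S"
      using S' Union_hyperedges[OF H] hyperedges_disjoint[OF H] S by blast
    have "twist G S' = kappa G ({f \<in> nongreens H - \<Union>S. col H f = Blue \<and> f \<notin> \<Union>S'} \<union> {f \<in> \<Union>S'. col H f = Red})"
    proof -
      have "{f \<in> edges G. col G f = Blue \<and> f \<notin> \<Union>S'} = {f \<in> nongreens H - \<Union>S. col H f = Blue \<and> f \<notin> \<Union>S'}"
        using colG[of Blue] by blast
      then show ?thesis by (simp add: twist_def red(2))
    qed
    also have "\<dots> = kappa H (({f \<in> nongreens H - \<Union>S. col H f = Blue \<and> f \<notin> \<Union>S'} \<union> {f \<in> \<Union>S'. col H f = Red})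
        \<union> {f \<in> \<Union>S. col H f = Red})"
      by (rule red(4)) (use S'U in blast)
    also have "({f \<in> nongreens H - \<Union>S. col H f = Blue \<and> f \<notin> \<Union>S'} \<union> {f \<in> \<Union>S'. col H f = Red})
        \<union> {f \<in> \<Union>S. col H f = Red}
      = {f \<in> edges H. col H f = Blue \<and> f \<notin> \<Union>(S \<union> S')} \<union> {f \<in> \<Union>(S \<union> S'). col H f = Red}"
      by (auto simp: nongreens_def)
    finally show ?thesis by (simp only: twist_def)
  qed
  have "num_f G = twist G {}" using num_f_kappa[OF G] by (simp add: twist_def)
  then show "num_f G = twist H S" using tw[of "{}"] by simp
qed

text \<open>Here the blue edges of \<open>e\<close> are added back, so \<open>e\<close> counts as a
  hyperedge outside \<open>S\<close>.\<close>

lemma contract_hyperedge: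
  assumes H: "gehm H" and e: "e \<in> hyperedges H"
  defines "G \<equiv> contract_hyperedge H e"
  shows "gehm G" "hyperedges G = hyperedges H - {e}"
    and "\<And>S. S \<subseteq> hyperedges H - {e} \<Longrightarrow> twist G S = twist H S"
proof -
  have c: "{Red, Blue} = {Blue, Red}" "Red \<noteq> Blue" by auto
  have eS: "{e} \<subseteq> hyperedges H" using e by simp
  note red = suppress_delete_contract[OF H saturated_Union[OF H eS] c,
      folded contract_hyperedge_eq, folded G_def]
  show G: "gehm G" by (rule red)
  show "hyperedges G = hyperedges H - {e}"
    using hyperedges_suppress_delete_contract[OF H eS c] unfolding G_def contract_hyperedge_eq .
  have eU: "e \<subseteq> nongreens H" using e Union_hyperedges[OF H] by blast
  show "twist G S = twist H S" if S: "S \<subseteq> hyperedges H - {e}" for S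
  proof -
    have SU: "\<Union>S \<subseteq> nongreens H - e"
      using S Union_hyperedges[OF H] hyperedges_disjoint[OF H] e by blast
    have "{f \<in> edges G. col G f = Blue \<and> f \<notin> \<Union>S} = {f \<in> nongreens G. col G f = Blue \<and> f \<notin> \<Union>S}"
      using coloured_edges_nongreens[of Blue G] by blast
    then have "twist G S = kappa G ({f \<in> nongreens H - \<Union>{e}. col H f = Blue \<and> f \<notin> \<Union>S} \<union> {f \<in> \<Union>S. col H f = Red})"
      by (simp only: twist_def red(2,3))
    also have "\<dots> = kappa H (({f \<in> nongreens H - \<Union>{e}. col H f = Blue \<and> f \<notin> \<Union>S} \<union> {f \<in> \<Union>S. col H f = Red})
        \<union> {f \<in> \<Union>{e}. col H f = Blue})"
      by (rule red(4)) (use SU in blast)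
    also have "({f \<in> nongreens H - \<Union>{e}. col H f = Blue \<and> f \<notin> \<Union>S} \<union> {f \<in> \<Union>S. col H f = Red})
        \<union> {f \<in> \<Union>{e}. col H f = Blue}
      = {f \<in> edges H. col H f = Blue \<and> f \<notin> \<Union>S} \<union> {f \<in> \<Union>S. col H f = Red}"
      using SU eU by (auto simp: nongreens_def)
    finally show ?thesis by (simp only: twist_def)
  qed
qed

subsection \<open>Exchanging the colours of a hyperedge\<close>

lemma sum_incidence_pair:
  assumes "finite X" "ends G f = {p, q}"
  shows "(\<Sum>x\<in>X. incidence G f x) = of_bool (p \<in> X) + of_bool (q \<in> X)"
proof -
  have "(\<Sum>x\<in>X. of_bool (x = z) :: nat) = of_bool (z \<in> X)" for z
    using assms(1) by (simp add: of_bool_def)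
  then show ?thesis by (simp add: incidence_pair[OF assms(2)] sum.distrib)
qed

text \<open>Handshaking: otherwise \<open>f\<close> is the only edge leaving the component of \<open>p\<close> in \<open>C - {f}\<close>, where
  the degrees of \<open>C\<close> have an even sum.\<close>

lemma cycle_minus_edge_linked:
  assumes H: "gehm H" and C: "C \<in> cycles H c c'" and f: "f \<in> C" and pq: "ends H f = {p, q}"
  shows "(p, q) \<in> linked H (C - {f})"
proof (rule ccontr)
  assume no: "(p, q) \<notin> linked H (C - {f})"
  define X where "X = linked H (C - {f}) `` {p}"
  have CE: "C \<subseteq> edges H" and Ce: "\<And>g. g \<in> C \<Longrightarrow> ends H g \<noteq> {}"
    and C2: "\<And>v. v \<in> \<Union>(ends H ` C) \<Longrightarrow> degree (H\<lparr>edges := C\<rparr>) v = 2"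
    using C by (auto simp: cycles_def is_cycle_def)
  have finC: "finite C" using CE H finite_subset by (auto simp: gehm_def)
  have XV: "X \<subseteq> \<Union>(ends H ` C)"
  proof
    fix w assume "w \<in> X"
    then have "(p, w) \<in> linked H (C - {f})" by (simp add: X_def)
    then show "w \<in> \<Union>(ends H ` C)"
      by (induction rule: linked_induct) (use f pq in blast)+
  qed
  have "X \<subseteq> verts H" using gehm_ends_subset[OF H] CE XV by blast
  then have finX: "finite X" using H by (simp add: gehm_def finite_subset)
  have pX: "p \<in> X" "q \<notin> X" using no by (simp_all add: X_def)
  have "(\<Sum>g\<in>C. \<Sum>x\<in>X. incidence H g x) = (\<Sum>x\<in>X. \<Sum>g\<in>C. incidence H g x)"
    by (rule sum.swap)
  also have "\<dots> = (\<Sum>x\<in>X. 2)"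
  proof (rule sum.cong)
    fix x assume "x \<in> X"
    then have "degree (H\<lparr>edges := C\<rparr>) x = 2" using C2 XV by blast
    then show "(\<Sum>g\<in>C. incidence H g x) = 2"
      using degree_sum_incidence[of "H\<lparr>edges := C\<rparr>" x] finC by (simp add: incidence_def)
  qed simp
  finally have "even (\<Sum>g\<in>C. \<Sum>x\<in>X. incidence H g x)" by simp
  moreover have "(\<Sum>g\<in>C. \<Sum>x\<in>X. incidence H g x)
      = (\<Sum>x\<in>X. incidence H f x) + (\<Sum>g\<in>C - {f}. \<Sum>x\<in>X. incidence H g x)"
    using finC f by (rule sum.remove)
  moreover have "(\<Sum>x\<in>X. incidence H f x) = 1"
    using sum_incidence_pair[OF finX pq] pX by simp
  moreover have "even (\<Sum>g\<in>C - {f}. \<Sum>x\<in>X. incidence H g x)"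
  proof (rule dvd_sum)
    fix g assume g: "g \<in> C - {f}"
    then have gE: "g \<in> edges H" "ends H g \<noteq> {}" using CE Ce by auto
    obtain a b where ab: "ends H g = {a, b}"
      using gE(2) by (cases rule: gehm_edge_cases[OF H gE(1)]) auto
    have "(a, b) \<in> linked H (C - {f})" using linked_edge[OF g, of a H b] ab by simp
    then have "a \<in> X \<longleftrightarrow> b \<in> X"
      unfolding X_def using linked_trans linked_sym by (metis Image_singleton_iff)
    then show "even (\<Sum>x\<in>X. incidence H g x)" by (simp add: sum_incidence_pair[OF finX ab])
  qed
  ultimately show False by simp
qed

text \<open>Either colour class of \<open>e\<close> is a perfect matching on the vertices of
  \<open>e\<close>, so both have half as many edges as there are vertices.\<close>

lemma card_hyperedge_colour:
  assumes H: "gehm H" and e: "e \<in> hyperedges H" and d: "d \<in> {Blue, Red}"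
  shows "card {f \<in> e. col H f = d} = deg e"
proof -
  have eC: "e \<in> cycles H Blue Red" using e by (simp add: hyperedges_def)
  have eE: "e \<subseteq> edges H" and ecol: "\<And>f. f \<in> e \<Longrightarrow> col H f \<in> {Blue, Red}"
    and ene: "\<And>f. f \<in> e \<Longrightarrow> ends H f \<noteq> {}"
    using eC by (auto simp: cycles_def is_cycle_def)
  have fine: "finite e" using eE H finite_subset by (auto simp: gehm_def)
  define V where "V = \<Union>(ends H ` e)"
  have VV: "V \<subseteq> verts H" using gehm_ends_subset[OF H] eE by (auto simp: V_def)
  then have finV: "finite V" using H finite_subset by (auto simp: gehm_def)
  have half: "card V = 2 * card {f \<in> e. col H f = k}" if k: "k \<in> {Blue, Red}" for k
  proof -
    have one: "(\<Sum>f | f \<in> e \<and> col H f = k. incidence H f v) = 1" if v: "v \<in> V" for v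
    proof -
      obtain g where g: "g \<in> e" "v \<in> ends H g" using v by (auto simp: V_def)
      have "(\<Sum>f | f \<in> e \<and> col H f = k. incidence H f v) = cdegree H k v"
        unfolding cdegree_def
      proof (rule sum.mono_neutral_left)
        show "finite {f. f \<in> edges H \<and> col H f = k}" using H by (simp add: gehm_def)
        show "{f. f \<in> e \<and> col H f = k} \<subseteq> {f. f \<in> edges H \<and> col H f = k}" using eE by auto
        show "\<forall>f\<in>{f. f \<in> edges H \<and> col H f = k} - {f. f \<in> e \<and> col H f = k}. incidence H f v = 0"
          using cycle_edges[OF H eC _ g, simplified] k by (auto simp: incidence_eq_0)
      qed
      then show ?thesis using gehm_cdegree[OF H] v VV by auto
    qed
    have "card V = (\<Sum>v\<in>V. \<Sum>f | f \<in> e \<and> col H f = k. incidence H f v)" by (simp add: one)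
    also have "\<dots> = (\<Sum>f | f \<in> e \<and> col H f = k. \<Sum>v\<in>V. incidence H f v)" by (rule sum.swap)
    also have "\<dots> = (\<Sum>f | f \<in> e \<and> col H f = k. 2)"
    proof (rule sum.cong)
      fix f assume "f \<in> {f. f \<in> e \<and> col H f = k}"
      then have f: "f \<in> e" by simp
      then have fE: "f \<in> edges H" "ends H f \<noteq> {}" using eE ene by auto
      obtain a b where ab: "ends H f = {a, b}"
        using fE(2) by (cases rule: gehm_edge_cases[OF H fE(1)]) auto
      then have "a \<in> V" "b \<in> V" using f by (auto simp: V_def)
      then show "(\<Sum>v\<in>V. incidence H f v) = 2" by (simp add: sum_incidence_pair[OF finV ab])
    qed simp
    finally show ?thesis by simp
  qed
  have "e = {f \<in> e. col H f = Blue} \<union> {f \<in> e. col H f = Red}" using ecol by auto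
  moreover have "card ({f \<in> e. col H f = Blue} \<union> {f \<in> e. col H f = Red})
      = card {f \<in> e. col H f = Blue} + card {f \<in> e. col H f = Red}"
    using fine by (intro card_Un_disjoint) auto
  ultimately have "card e = card {f \<in> e. col H f = Blue} + card {f \<in> e. col H f = Red}" by simp
  then show ?thesis using half[of Blue] half[of Red] d by (auto simp: deg_def)
qed

text \<open>Adding the edges of colour \<open>c'\<close> to those of colour \<open>c\<close> merges components at most \<open>deg e - 1\<close>
  times, as the last of them closes the cycle.\<close>

lemma kappa_exchange:
  assumes H: "gehm H" and e: "e \<in> hyperedges H" and c: "{c, c'} = {Blue, Red}"
  shows "kappa H (M \<union> {f \<in> e. col H f = c}) + 1 \<le> kappa H (M \<union> {f \<in> e. col H f = c'}) + deg e"
proof -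
  let ?B = "{f \<in> e. col H f = c}" and ?R = "{f \<in> e. col H f = c'}"
  have eC: "e \<in> cycles H Blue Red" using e by (simp add: hyperedges_def)
  have eE: "e \<subseteq> edges H" and ecol: "\<And>f. f \<in> e \<Longrightarrow> col H f \<in> {Blue, Red}"
    and ene: "\<And>f. f \<in> e \<Longrightarrow> ends H f \<noteq> {}" and "e \<noteq> {}"
    using eC by (auto simp: cycles_def is_cycle_def)
  have finV: "finite (verts H)" and fine: "finite e" using eE H finite_subset by (auto simp: gehm_def)
  have pair: "\<exists>p q. ends H f = {p, q}" if "f \<in> e" for f
  proof -
    have fE: "f \<in> edges H" "ends H f \<noteq> {}" using eE ene that by auto
    then show ?thesis by (cases rule: gehm_edge_cases[OF H fE(1)]) auto
  qed
  have c': "c' \<in> {Blue, Red}" using c by blast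
  have cardR: "card ?R = deg e" by (rule card_hyperedge_colour[OF H e c'])
  obtain f where f: "f \<in> ?R"
  proof -
    obtain g where g: "g \<in> e" using \<open>e \<noteq> {}\<close> by blast
    then have gE: "g \<in> edges H" "ends H g \<noteq> {}" using eE ene by auto
    then obtain v where v: "v \<in> ends H g" "v \<in> verts H" using gehm_ends_subset[OF H] by blast
    obtain f where "f \<in> edges H" "col H f = c'" "v \<in> ends H f" by (rule gehm_incident[OF H v(2)])
    moreover from this have "f \<in> e" using cycle_edges[OF H eC _ g v(1), of f] c' by simp
    ultimately show thesis using that by blast
  qed
  \<comment> \<open>This contains all of \<open>e\<close> except \<open>f\<close>, so the ends of
    \<open>f\<close> are already linked and adding \<open>f\<close> costs nothing.\<close>
  let ?F = "M \<union> greens H \<union> ?B \<union> (?R - {f})"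
  obtain p q where pq: "ends H f = {p, q}" using pair f by blast
  have "e - {f} \<subseteq> ?F" using ecol c by blast
  moreover have "(p, q) \<in> linked H (e - {f})"
    using cycle_minus_edge_linked[OF H eC _ pq] f by simp
  ultimately have "(p, q) \<in> linked H ?F" using linked_mono by blast
  then have "comps H (insert f ?F) = comps H ?F"
    using linked_sym by (intro comps_insert_eq) (auto simp: pq)
  moreover have "comps H (insert f ?F) \<le> comps H (M \<union> ?R \<union> greens H)"
    using f by (intro comps_antimono[OF finV]) auto
  moreover have "comps H (M \<union> ?B \<union> greens H) \<le> comps H ?F + card (?R - {f})"
  proof -
    have "comps H (M \<union> ?B \<union> greens H) \<le> comps H (M \<union> ?B \<union> greens H \<union> (?R - {f})) + card (?R - {f})"
      by (rule comps_union_le[OF finV]) (use fine pair in auto)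
    also have "M \<union> ?B \<union> greens H \<union> (?R - {f}) = ?F" by blast
    finally show ?thesis .
  qed
  moreover have "card (?R - {f}) + 1 = deg e"
    using card_Suc_Diff1[OF _ f] fine cardR by simp
  ultimately show ?thesis unfolding kappa_def by linarith
qed

text \<open>Only the colour used on \<open>e\<close> changes, over a common rest \<open>?M\<close>.
  The first bound serves the exponents of x - 1, the second those of y - 1.\<close>

lemma twist_insert:
  assumes H: "gehm H" and S: "S \<subseteq> hyperedges H" and e: "e \<in> hyperedges H" "e \<notin> S"
  shows "twist H S + 1 \<le> twist H (insert e S) + deg e" "twist H (insert e S) + 1 \<le> twist H S + deg e"
proof -
  let ?M = "{f \<in> edges H. col H f = Blue \<and> f \<notin> \<Union>S \<and> f \<notin> e} \<union> {f \<in> \<Union>S. col H f = Red}"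
  have eE: "e \<subseteq> edges H" using e(1) by (auto simp: hyperedges_def cycles_def is_cycle_def)
  have "e \<inter> \<Union>S = {}" using hyperedges_disjoint[OF H e(1)] S e(2) by blast
  then have "{f \<in> edges H. col H f = Blue \<and> f \<notin> \<Union>S} \<union> {f \<in> \<Union>S. col H f = Red} = ?M \<union> {f \<in> e. col H f = Blue}"
    using eE by blast
  then have 1: "twist H S = kappa H (?M \<union> {f \<in> e. col H f = Blue})" by (simp only: twist_def)
  have "{f \<in> edges H. col H f = Blue \<and> f \<notin> \<Union>(insert e S)} \<union> {f \<in> \<Union>(insert e S). col H f = Red}
      = ?M \<union> {f \<in> e. col H f = Red}"
    by blast
  then have 2: "twist H (insert e S) = kappa H (?M \<union> {f \<in> e. col H f = Red})" by (simp only: twist_def)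
  show "twist H S + 1 \<le> twist H (insert e S) + deg e"
    unfolding 1 2 by (rule kappa_exchange[OF H e(1)]) simp
  show "twist H (insert e S) + 1 \<le> twist H S + deg e"
    unfolding 1 2 by (rule kappa_exchange[OF H e(1)]) auto
qed

subsection \<open>The Tutte polynomial\<close>

text \<open>Twice the exponent of x - 1 in the term of \<open>A\<close>, where \<open>S\<close> is
  the complement of \<open>A\<close>; v cancels because deletion preserves it.\<close>

definition x_exponent :: "('v, 'e) cgraph \<Rightarrow> 'e set set \<Rightarrow> int" where
  "x_exponent H S = int (deg_sum S) - int (card S) + int (twist H S) - int (twist H {})"

text \<open>Twice the exponent of y - 1 in the term of \<open>A\<close>.\<close>

definition y_exponent :: "('v, 'e) cgraph \<Rightarrow> 'e set set \<Rightarrow> int" where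
  "y_exponent H A = int (deg_sum A) - int (card A) - int (num_v H) + int (twist H (hyperedges H - A))"

lemma deg_sum_insert: "finite S \<Longrightarrow> e \<notin> S \<Longrightarrow> deg_sum (insert e S) = deg e + deg_sum S"
  by (simp add: deg_sum_def)

text \<open>The exponent is 0 at the empty set and, by \<open>twist_insert\<close>, does not
  decrease when a hyperedge is added. The same works for \<open>y_exponent\<close>, where
  \<open>twist_all\<close> gives the value 0 at the start.\<close>

lemma x_exponent_nonneg:
  assumes H: "gehm H" and S: "S \<subseteq> hyperedges H"
  shows "0 \<le> x_exponent H S"
proof -
  have "finite S" using S finite_hyperedges[OF H] finite_subset by blast
  then show ?thesis using S
  proof (induction S rule: finite_induct)
    case empty then show ?case by (simp add: x_exponent_def deg_sum_def)
  next
    case (insert e S)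
    then show ?case using twist_insert(1)[OF H, of S e] by (simp add: x_exponent_def deg_sum_insert)
  qed
qed

text \<open>Once every hyperedge is exchanged, only red and green edges remain. This is dual to the
  value f at the empty set.\<close>

lemma twist_all:
  assumes H: "gehm H"
  shows "twist H (hyperedges H) = num_v H"
proof -
  have "{f \<in> edges H. col H f = Blue \<and> f \<notin> nongreens H} \<union> {f \<in> nongreens H. col H f = Red}
      = {f \<in> edges H. col H f = Red}"
    by (auto simp: nongreens_def)
  then show ?thesis by (simp add: twist_def Union_hyperedges[OF H] num_v_kappa[OF H])
qed

lemma y_exponent_nonneg:
  assumes H: "gehm H" and A: "A \<subseteq> hyperedges H"
  shows "0 \<le> y_exponent H A"
proof -
  have "finite A" using A finite_hyperedges[OF H] finite_subset by blast
  then show ?thesis using A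
  proof (induction A rule: finite_induct)
    case empty then show ?case by (simp add: y_exponent_def deg_sum_def twist_all[OF H])
  next
    case (insert e A)
    have "insert e (hyperedges H - insert e A) = hyperedges H - A" using insert by blast
    then show ?case using insert twist_insert(2)[OF H, of "hyperedges H - insert e A" e]
      by (simp add: y_exponent_def deg_sum_insert)
  qed
qed

lemma rho_eq: "2 * rho H = of_int (int (num_v H) - int (num_e H) + int (deg_sum (hyperedges H)) - int (num_f H))"
  by (simp add: rho_def gamma_def field_simps)

text \<open>Doubling makes the exponents integers, so the floor in \<open>half_pow\<close> loses
  nothing.\<close>

lemma tutte_exponents:
  assumes H: "gehm H"
  shows "tutte H x y = (\<Sum>A\<in>Pow (hyperedges H).
    csqrt (x - 1) powi x_exponent H (hyperedges H - A) * csqrt (y - 1) powi y_exponent H A)"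
  unfolding tutte_def
proof (rule sum.cong)
  fix A assume "A \<in> Pow (hyperedges H)"
  then have A: "A \<subseteq> hyperedges H" by simp
  let ?E = "hyperedges H" and ?S = "hyperedges H - A"
  have finE: "finite ?E" by (rule finite_hyperedges[OF H])
  note del = delete_hyperedges[OF H, of ?S, folded restrict_to_def]
  have EA: "?E - ?S = A" using A by blast
  have "num_f H = twist H {}" using num_f_kappa[OF H] by (simp add: twist_def)
  moreover have "deg_sum ?E = deg_sum A + deg_sum ?S" "card ?E = card A + card ?S"
    using sum.subset_diff[OF A finE, of deg] card_Un_disjoint[of A ?S] A finE finite_subset[OF A finE]
    by (auto simp: deg_sum_def Un_absorb1)
  moreover have "2 * rho (restrict_to H A)
      = of_int (int (num_v H) - int (card A) + int (deg_sum A) - int (twist H ?S))"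
    unfolding rho_eq num_e_def using del(2-4) EA by simp
  moreover have "2 * rho H = of_int (int (num_v H) - int (card ?E) + int (deg_sum ?E) - int (num_f H))"
    unfolding rho_eq num_e_def ..
  ultimately have
    "2 * (rho H - rho (restrict_to H A)) = of_int (x_exponent H ?S)"
    "2 * (real (deg_sum A) - real (card A) - rho (restrict_to H A)) = of_int (y_exponent H A)"
    unfolding x_exponent_def y_exponent_def right_diff_distrib by simp_all
  then show "half_pow (x - 1) (rho H - rho (restrict_to H A)) *
      half_pow (y - 1) (real (deg_sum A) - real (card A) - rho (restrict_to H A))
    = csqrt (x - 1) powi x_exponent H ?S * csqrt (y - 1) powi y_exponent H A"
    unfolding half_pow_def by simp
qed simp

text \<open>At \<open>z = 0\<close> the law fails when \<open>a + b = 0\<close> with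
  \<open>a\<close> nonzero, as for 1 and -1; nonnegative exponents exclude this.\<close>

lemma powi_add_nonneg:
  fixes z :: "'a :: field"
  assumes "0 \<le> a" "0 \<le> b"
  shows "z powi (a + b) = z powi a * z powi b"
proof (cases "a + b = 0")
  case True
  then have "a = 0" "b = 0" using assms by auto
  then show ?thesis by simp
qed (simp add: power_int_add)

lemma sum_Pow_split:
  assumes "finite E" "e \<in> E"
  shows "(\<Sum>A\<in>Pow E. F A) = (\<Sum>A\<in>Pow (E - {e}). F A) + (\<Sum>A\<in>Pow (E - {e}). F (insert e A))"
proof -
  have "Pow E = Pow (E - {e}) \<union> insert e ` Pow (E - {e})"
    using Pow_insert[of e "E - {e}"] unfolding insert_Diff[OF assms(2)] .
  moreover have "inj_on (insert e) (Pow (E - {e}))" by (rule inj_onI) blast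
  moreover have "Pow (E - {e}) \<inter> insert e ` Pow (E - {e}) = {}" by blast
  moreover have "finite (Pow (E - {e}))" using assms(1) by simp
  ultimately have "(\<Sum>A\<in>Pow E. F A) = (\<Sum>A\<in>Pow (E - {e}). F A) + (\<Sum>A\<in>insert e ` Pow (E - {e}). F A)"
    by (metis sum.union_disjoint finite_imageI)
  then show ?thesis using sum.reindex[OF \<open>inj_on _ _\<close>, of F] by (simp add: o_def)
qed

theorem theorem1:
  fixes H :: "('v, 'e) cgraph" and x y :: complex
  assumes "gehm H"
  shows "(hyperedges H = {} \<longrightarrow> tutte H x y = 1) \<and>
    (\<forall>e\<in>hyperedges H.
       tutte H x y =
         csqrt (x - 1) powi
           (int (num_f (delete_hyperedge H e)) - int (num_f H) + int (deg e) - 1) *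
           tutte (delete_hyperedge H e) x y +
         csqrt (y - 1) powi
           (int (num_v (contract_hyperedge H e)) - int (num_v H) + int (deg e) - 1) *
           tutte (contract_hyperedge H e) x y)"
proof (intro conjI impI ballI)
  assume "hyperedges H = {}"
  \<comment> \<open>Without hyperedges the two extreme values of \<open>twist\<close> coincide, so v
    = f and the only term has both exponents 0.\<close>
  then show "tutte H x y = 1"
    using twist_all[OF assms]
    by (simp add: tutte_exponents[OF assms] x_exponent_def y_exponent_def deg_sum_def)
next
  fix e assume e: "e \<in> hyperedges H"
  let ?E = "hyperedges H" and ?X = "csqrt (x - 1)" and ?Y = "csqrt (y - 1)"
  define D where "D = delete_hyperedge H e"
  define C where "C = contract_hyperedge H e"
  define a where "a = int (num_f D) - int (num_f H) + int (deg e) - 1"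
  define b where "b = int (num_v C) - int (num_v H) + int (deg e) - 1"
  have finE: "finite ?E" by (rule finite_hyperedges[OF assms])
  have eS: "{e} \<subseteq> ?E" using e by simp
  note del = delete_hyperedges[OF assms eS, folded delete_hyperedge_def, folded D_def]
  note con = contract_hyperedge[OF assms e, folded C_def]
  have f: "num_f H = twist H {}" using num_f_kappa[OF assms] by (simp add: twist_def)
  have "a = x_exponent H {e}" by (simp add: a_def x_exponent_def del(4) f deg_sum_def)
  then have a0: "0 \<le> a" using x_exponent_nonneg[OF assms eS] by simp
  \<comment> \<open>By \<open>twist_all\<close>, \<open>num_v C\<close> is \<open>twist C\<close> at
    all hyperedges of \<open>C\<close>, that is, \<open>twist H (?E - {e})\<close>.\<close>
  have "b = y_exponent H {e}"
    using con(3)[of "?E - {e}"] twist_all[OF con(1)] con(2)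
    by (simp add: b_def y_exponent_def deg_sum_def)
  then have b0: "0 \<le> b" using y_exponent_nonneg[OF assms eS] by simp
  \<comment> \<open>If \<open>e\<close> is not in \<open>A\<close>, it is among the hyperedges
    deleted for \<open>A\<close>. Deleting it first splits off \<open>a\<close>; the exponent of y -
    1 is unchanged since v is.\<close>
  have not_in: "?X powi x_exponent H (?E - A) * ?Y powi y_exponent H A
      = ?X powi a * (?X powi x_exponent D (hyperedges D - A) * ?Y powi y_exponent D A)"
    if A: "A \<subseteq> ?E - {e}" for A
  proof -
    let ?S = "?E - {e} - A"
    have S: "insert e ?S = ?E - A" "finite ?S" "e \<notin> ?S" using A e finE by auto
    have S': "hyperedges D - A = ?S" "?S \<subseteq> hyperedges D" using del(2) by auto
    have "twist D ?S = twist H (?E - A)" "twist D {} = twist H {e}"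
      using del(5)[of ?S] del(5)[of "{}"] S by auto
    moreover have "deg_sum (?E - A) = deg e + deg_sum ?S" "card (?E - A) = card ?S + 1"
      using deg_sum_insert[OF S(2,3)] card_insert_disjoint[OF S(2,3)] S(1) by simp_all
    ultimately have "x_exponent H (?E - A) = a + x_exponent D ?S" "y_exponent H A = y_exponent D A"
      unfolding S' x_exponent_def y_exponent_def a_def del(3,4) f by simp_all
    then show ?thesis
      using powi_add_nonneg[OF a0 x_exponent_nonneg[OF del(1) S'(2)], of ?X] S'(1) by simp
  qed
  \<comment> \<open>If \<open>e\<close> is retained, the sets that enter \<open>twist\<close> avoid
    \<open>e\<close>, where \<open>C\<close> and \<open>H\<close> agree. Only the terms deg(e) - 1
    and the change of v remain, and they make up \<open>b\<close>.\<close>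
  have is_in: "?X powi x_exponent H (?E - insert e A) * ?Y powi y_exponent H (insert e A)
      = ?Y powi b * (?X powi x_exponent C (hyperedges C - A) * ?Y powi y_exponent C A)"
    if A: "A \<subseteq> ?E - {e}" for A
  proof -
    let ?S = "?E - {e} - A"
    have S: "?E - insert e A = ?S" "finite A" "e \<notin> A" using A finE finite_subset by auto
    have C': "hyperedges C - A = ?S" "A \<subseteq> hyperedges C" using con(2) A by auto
    have "twist C ?S = twist H ?S" "twist C {} = twist H {}" using con(3) by auto
    then have "x_exponent H ?S = x_exponent C ?S" "y_exponent H (insert e A) = b + y_exponent C A"
      using S(2,3) unfolding x_exponent_def y_exponent_def b_def C'(1) S(1)
      by (simp_all add: deg_sum_insert)
    then show ?thesis
      using powi_add_nonneg[OF b0 y_exponent_nonneg[OF con(1) C'(2)], of ?Y] C'(1) S(1) by simp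
  qed
  have "tutte H x y = ?X powi a * tutte D x y + ?Y powi b * tutte C x y"
    unfolding tutte_exponents[OF assms] tutte_exponents[OF del(1)] tutte_exponents[OF con(1)]
      sum_Pow_split[OF finE e] del(2) con(2) sum_distrib_left
    using not_in is_in del(2) con(2) by (intro arg_cong2[where f = "(+)"] sum.cong) auto
  then show "tutte H x y = ?X powi (int (num_f (delete_hyperedge H e)) - int (num_f H) + int (deg e) - 1) *
      tutte (delete_hyperedge H e) x y +
    ?Y powi (int (num_v (contract_hyperedge H e)) - int (num_v H) + int (deg e) - 1) *
      tutte (contract_hyperedge H e) x y"
    by (simp only: a_def b_def D_def C_def)
qed

end
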